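(* Let $n\ge2$ be an integer, let $C>\frac1n$ and let $h_0<0$. Then there exists a solution $r(h)$ of \[ \frac{r''}{1+r'^2}=\frac{n-1}{r}-\frac{1+r'^2}{C(r-hr')} \] that is defined for all $h>h_0$ and such that the curve described by $r=r(h)$ intersects the $h$-axis perpendicularly at $h=h_0$. Moreover, the solution $r(h)$ has the following behavior, depending on $C$: (1) If $C=\frac1{n-1}$, then $r'>0$, $r''<0$, and there exists $0<r_{top}<\infty$ such that $\lim_{h\to\infty}r(h)=r_{top}$. (2) If $C>\frac1{n-1}$, then $r'>0$, $r''<0$, and $\lim_{h\to\infty}r(h)=\infty$. (3) If $\frac1n<C<\frac1{n-1}$, then there exists a point $h_1$ such that $r''(h)$ has the same sign as $h-h_1$, and $\lim_{h\to\infty}r(h)=0$.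
   Context: A solution of the differential equation on an interval is a twice differentiable function $r=r(h)>0$ with $r-hr'\ne0$ on the interval satisfying the equation there; primes denote $d/dh$. The curve lies in the half-plane with coordinates $(r,h)$, $r\geq 0$, whose boundary $\{r=0\}$ is the $h$-axis (the axis of rotation); intersecting the $h$-axis perpendicularly at $h=h_0$ means $\lim_{h\to h_0^+}r(h)=0$ and $\lim_{h\to h_0^+}r'(h)=+\infty$. (The equation says that rotating the profile curve about the $h$-axis in $\mathbb{R}^{n+1}$ gives a hypersurface satisfying $-\langle\overrightarrow{H},X\rangle=\frac1C$, where $X$ is the position vector and $\overrightarrow H$ the mean curvature vector, i.e. a homothetic expander for the inverse mean curvature flow.) *)

theory Defs
  imports "HOL-Analysis.Analysis"
begin

text \<open>
  Profile curves \<open>r = r(h)\<close> of rotational homothetic expanders for the inverse mean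
  curvature flow in dimension \<open>n + 1\<close>. Since \<^const>\<open>deriv\<close> and differentiability
  at \<^term>\<open>at h\<close> are two-sided, \<open>expander_solution_on\<close> is meant for open intervals \<open>I\<close>.
\<close>

definition expander_solution_on :: "nat \<Rightarrow> real \<Rightarrow> real set \<Rightarrow> (real \<Rightarrow> real) \<Rightarrow> bool" where
  "expander_solution_on n C I r \<longleftrightarrow>
     (\<forall>h\<in>I. r differentiable (at h) \<and> deriv r differentiable (at h) \<and>
        r h > 0 \<and> r h - h * deriv r h \<noteq> 0 \<and>
        deriv (deriv r) h / (1 + (deriv r h)\<^sup>2) =
          (real n - 1) / r h - (1 + (deriv r h)\<^sup>2) / (C * (r h - h * deriv r h)))"

definition meets_axis_perpendicularly_at :: "(real \<Rightarrow> real) \<Rightarrow> real \<Rightarrow> bool" where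
  "meets_axis_perpendicularly_at r h0 \<longleftrightarrow>
     (r \<longlongrightarrow> 0) (at_right h0) \<and> filterlim (deriv r) at_top (at_right h0)"

end

(*
  The equation is invariant under dilations, so in the variables x = h/r and
  u = (h + r r')/(r - h r') it becomes the scalar equation
    u' = (1 + u^2)/(1 + x^2) * (n + (n-1) u x - (1 + u^2)/C),
  and a curve meeting the axis perpendicularly at h0 < 0 corresponds to a solution u on the whole
  line with 0 < u and 0 < 1 + x u. Such a solution is found between the subsolution 0 and an explicit
  supersolution. The curve is recovered in the parameter x: its distance rho to the origin satisfies
  (ln rho)' = u/(1 + x^2), and r = rho/sqrt(1 + x^2), h = x r.

  With c = (n-1)C, the sign of r'' is that of G = c(1 + x u) - (1 + u^2), and at a zero of G the sign
  of G' is that of x - u. Moreover r' > 0 iff u > x. If c >= 1 then u > x everywhere, so G stays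
  negative; if c < 1 then zeros of G have x > u, so G changes sign exactly once. The limits of r
  follow by integrating linear bounds of the form m x <= u <= nC + c x.
*)

theory Submission
  imports Defs "HOL-Real_Asymp.Real_Asymp"
begin

text \<open>On the axis \<open>r\<close> vanishes and \<open>r'\<close> is infinite, so the initial
  value problem in \<open>h\<close> is singular. In the variable \<open>x\<close> the axis lies at
  -infinity, where no initial value can be prescribed; instead \<open>u\<close> is trapped below -
  1/x on the far left. This keeps 1 + x u from becoming negative, and r' >= - x then gives the
  perpendicular contact. As \<open>F\<close> is quartic in \<open>u\<close> and the trapping region
  widens with \<open>x\<close>, the iteration relies only on a bound for the decrease of
  \<open>F\<close> in \<open>u\<close>, with a weight depending on \<open>x\<close>.

  The formula r' = (u - x)/(1 + x u) = tan (arctan u - arctan x) shows that straight lines satisfy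
  u' = (1 + u^2)/(1 + x^2); \<open>G\<close> measures the deviation from this. The threshold c = 1
  comes from r = rho/sqrt(1 + x^2): a bound of slope m on \<open>u\<close> contributes (1 +
  x^2)^(m/2) to rho, so slopes are compared with 1.\<close>

section \<open>Monotone iteration for scalar equations\<close>

text \<open>First-crossing argument: just before a first zero \<open>w\<close> would be negative,
  because its derivative there is positive. The slope is tested only where \<open>w\<close>
  vanishes, so barrier comparisons reduce to computations at touching points.\<close>

lemma stays_positive:
  fixes w w' :: "real \<Rightarrow> real"
  assumes der: "\<And>x. a \<le> x \<Longrightarrow> x \<le> b \<Longrightarrow> (w has_real_derivative w' x) (at x)"
    and "a < b" and "0 \<le> w a"
    and up: "\<And>x. a \<le> x \<Longrightarrow> x \<le> b \<Longrightarrow> w x = 0 \<Longrightarrow> 0 < w' x"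
  shows "0 < w b"
proof (rule ccontr)
  assume nb: "\<not> 0 < w b"
  obtain a' where a': "a \<le> a'" "a' < b" "0 < w a'"
  proof (cases "w a = 0")
    case True
    have "(w has_real_derivative w' a) (at a)" "0 < w' a"
      using der[of a] up[of a] True \<open>a < b\<close> by auto
    then obtain d where "d > 0" "\<forall>h>0. h < d \<longrightarrow> w a < w (a + h)"
      using DERIV_pos_inc_right by blast
    then have "w a < w (a + min (d/2) ((b-a)/2))" using \<open>a < b\<close> by (auto simp: min_def)
    then show ?thesis using that[of "a + min (d/2) ((b-a)/2)"] \<open>a < b\<close> \<open>d > 0\<close> True
      by (auto simp: min_def field_simps split: if_splits)
  next
    case False
    then show ?thesis using that[of a] assms by auto
  qed
  have cont: "continuous_on {a'..b} w"
  proof (intro continuous_at_imp_continuous_on ballI)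
    fix x assume "x \<in> {a'..b}"
    then show "isCont w x" using der[of x] a' by (auto intro: DERIV_isCont)
  qed
  define Z where "Z = {x \<in> {a'..b}. w x = 0}"
  have "closed Z" unfolding Z_def
    by (rule continuous_closed_preimage_constant[OF cont]) auto
  moreover have "Z \<noteq> {}"
    using IVT2'[of w b 0 a'] nb a' cont unfolding Z_def by force
  moreover have bd: "bdd_below Z" unfolding Z_def by (rule bdd_belowI[of _ a']) auto
  ultimately have "Inf Z \<in> Z" by (intro closed_contains_Inf)
  define x0 where "x0 = Inf Z"
  have x0: "a' \<le> x0" "x0 \<le> b" "w x0 = 0" using \<open>Inf Z \<in> Z\<close> unfolding Z_def x0_def by auto
  then have "a' < x0" using a' by (cases "a' = x0") auto
  have "(w has_real_derivative w' x0) (at x0)" "0 < w' x0" using x0 a' der up by auto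
  then obtain d where d: "d > 0" "\<forall>h>0. h < d \<longrightarrow> w (x0 - h) < w x0"
    using DERIV_pos_inc_left by blast
  define y where "y = x0 - min (d/2) ((x0-a')/2)"
  have y: "a' < y" "y < x0" "w y < 0"
    using d \<open>a' < x0\<close> x0 unfolding y_def by (auto simp: min_def field_simps)
  \<comment> \<open>\<open>w\<close> is positive at \<open>a'\<close> and negative at
    \<open>y\<close>, so it vanishes before the smallest zero \<open>x0\<close>.\<close>
  have "\<exists>z\<ge>a'. z \<le> y \<and> w z = 0"
    by (rule IVT2') (use y a' x0 in \<open>auto intro: continuous_on_subset[OF cont]\<close>)
  then obtain z where "a' \<le> z" "z \<le> y" "w z = 0" by blast
  then have "z \<in> Z" "z < x0" using y x0 unfolding Z_def by simp_all
  then show False using cInf_lower[OF _ bd, of z] unfolding x0_def by linarith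
qed

lemma antiderivative_exists:
  fixes h :: "real \<Rightarrow> real"
  assumes "continuous_on UNIV h"
  obtains H where "\<And>x. (H has_real_derivative h x) (at x)"
proof -
  have "\<exists>F. \<forall>x :: real. (-\<infinity>::ereal) < x \<longrightarrow> x < (\<infinity>::ereal) \<longrightarrow> (F has_vector_derivative h x) (at x)"
    by (rule einterval_antiderivative) (use assms in \<open>auto simp: continuous_on_eq_continuous_at\<close>)
  then show ?thesis using that by (auto simp: has_real_derivative_iff_has_vector_derivative)
qed

lemma continuous_on_integral_upper:
  fixes h :: "real \<Rightarrow> real"
  assumes "continuous_on UNIV h"
  shows "continuous_on UNIV (\<lambda>x. integral {a..x} h)"
proof -
  obtain H where H: "\<And>x. (H has_real_derivative h x) (at x)"
    using antiderivative_exists[OF assms] by blast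
  \<comment> \<open>\<open>max\<close> covers x < a as well, where the interval is empty and the
    integral is 0.\<close>
  have "integral {a..x} h = H (max a x) - H a" for x
  proof (cases "a \<le> x")
    case True
    have "(h has_integral H x - H a) {a..x}"
      using True H by (intro fundamental_theorem_of_calculus)
        (auto simp: has_real_derivative_iff_has_vector_derivative has_vector_derivative_at_within)
    then show ?thesis using True by (simp add: integral_unique)
  qed auto
  moreover have "continuous_on UNIV H" using H
    by (intro continuous_at_imp_continuous_on) (auto intro: DERIV_isCont)
  then have "continuous_on UNIV (\<lambda>x. H (max a x) - H a)"
    by (intro continuous_on_diff continuous_on_const
        continuous_on_compose2[of UNIV H UNIV "max a"] continuous_on_max continuous_on_id) auto
  ultimately show ?thesis by simp
qed

lemma exp_integrating_factor:
  fixes L l v :: "real \<Rightarrow> real"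
  assumes "(L has_real_derivative l x) (at x)" "(v has_real_derivative d) (at x)"
  shows "((\<lambda>x. exp (L x) * v x) has_real_derivative exp (L x) * (d + l x * v x)) (at x)"
  using DERIV_mult[OF DERIV_fun_exp[OF assms(1)] assms(2)] by (simp add: algebra_simps)

text \<open>Solves the integral equation
  \<open>u x = exp (- L x) * \<integral>\<^bsub>-\<infinity>\<^esub>\<^bsup>x\<^esup> exp L * (F u + l u)\<close> by monotone iteration from \<open>0\<close>.
  The left endpoint of the integral recedes to \<open>-\<infinity>\<close> along the iteration, so that only
  proper integrals occur; they vanish when the endpoint is still to the right of \<open>x\<close>.\<close>

lemma monotone_iteration_solution:
  fixes F :: "real \<Rightarrow> real \<Rightarrow> real" and L l \<beta> \<beta>' :: "real \<Rightarrow> real"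
  assumes contF: "continuous_on UNIV (\<lambda>z. F (fst z) (snd z))"
    and L: "\<And>x. (L has_real_derivative l x) (at x)" and contl: "continuous_on UNIV l"
    and F0: "\<And>x. 0 \<le> F x 0"
    and fin: "finite S" and cont\<beta>: "continuous_on UNIV \<beta>"
    and d\<beta>: "\<And>x. x \<notin> S \<Longrightarrow> (\<beta> has_real_derivative \<beta>' x) (at x)"
    and super: "\<And>x. F x (\<beta> x) \<le> \<beta>' x" and \<beta>0: "\<And>x. 0 \<le> \<beta> x"
    and mono: "\<And>x u v. 0 \<le> u \<Longrightarrow> u \<le> v \<Longrightarrow> v \<le> \<beta> x \<Longrightarrow> F x u + l x * u \<le> F x v + l x * v"
  obtains u where "\<And>x. (u has_real_derivative F x (u x)) (at x)"
    "\<And>x. 0 \<le> u x" "\<And>x. u x \<le> \<beta> x"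
proof -
  \<comment> \<open>The integrating factor \<open>exp L\<close> turns u' = F into (exp L u)' =
    \<open>g\<close>; by \<open>mono\<close> the new integrand is nondecreasing in \<open>v\<close>
    between 0 and \<open>\<beta>\<close>.\<close>
  define g where "g x v = exp (L x) * (F x v + l x * v)" for x v
  define U where "U = rec_nat (\<lambda>_. 0) (\<lambda>k u x. exp (- L x) * integral {- real k..x} (\<lambda>y. g y (u y)))"
  have U0: "U 0 = (\<lambda>_. 0)" and
    US: "U (Suc k) = (\<lambda>x. exp (- L x) * integral {- real k..x} (\<lambda>y. g y (U k y)))" for k
    unfolding U_def by simp_all
  have contL: "continuous_on UNIV L" using L
    by (intro continuous_at_imp_continuous_on) (auto intro: DERIV_isCont)
  have contg: "continuous_on A (\<lambda>y. g y (v y))" if "continuous_on A v" for v A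
    unfolding g_def
    by (intro continuous_intros continuous_on_subset[OF contL] continuous_on_subset[OF contl]
        continuous_on_compose2[OF contF, of _ "\<lambda>y. (y, v y)", simplified] that) auto
  have gint: "(\<lambda>y. g y (v y)) integrable_on {a..b}" if "continuous_on UNIV v" for v a b
    by (rule integrable_continuous_interval, rule contg, rule continuous_on_subset[OF that]) auto
  have g_mono: "g x u \<le> g x v" if "0 \<le> u" "u \<le> v" "v \<le> \<beta> x" for x u v
    unfolding g_def using mono[OF that] by simp
  have g0: "0 \<le> g x 0" for x unfolding g_def using F0 by simp
  have g_nonneg: "0 \<le> g x v" if "0 \<le> v" "v \<le> \<beta> x" for x v
    using g_mono[of 0 v x] g0[of x] that by linarith
  \<comment> \<open>The bound is uniform in \<open>a\<close>: off \<open>S\<close>,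
    \<open>exp L * \<beta>\<close> is an antiderivative of a majorant of the integrand, and its
    value at \<open>a\<close> is nonnegative.\<close>
  have g\<beta>: "integral {a..x} (\<lambda>y. g y (v y)) \<le> exp (L x) * \<beta> x"
    if v: "continuous_on UNIV v" "\<And>y. 0 \<le> v y" "\<And>y. v y \<le> \<beta> y" for a x v
  proof (cases "a \<le> x")
    case True
    have "((\<lambda>y. exp (L y) * (\<beta>' y + l y * \<beta> y)) has_integral
        (exp (L x) * \<beta> x - exp (L a) * \<beta> a)) {a..x}"
      by (rule fundamental_theorem_of_calculus_interior_strong[OF fin True])
        (auto simp: has_real_derivative_iff_has_vector_derivative[symmetric]
          intro!: exp_integrating_factor L d\<beta> continuous_intros
          intro: continuous_on_subset[OF contL] continuous_on_subset[OF cont\<beta>])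
    moreover have "g y (v y) \<le> exp (L y) * (\<beta>' y + l y * \<beta> y)" for y
      using g_mono[of "v y" "\<beta> y" y] v super[of y] unfolding g_def
      by (smt (verit) exp_gt_zero mult_left_mono)
    ultimately have "integral {a..x} (\<lambda>y. g y (v y)) \<le> exp (L x) * \<beta> x - exp (L a) * \<beta> a"
      using integrable_integral[OF gint[OF v(1)]] by (blast intro: has_integral_le)
    then show ?thesis using \<beta>0[of a] by (smt (verit) exp_gt_zero mult_nonneg_nonneg)
  qed (use \<beta>0 in auto)
  have U_ok: "continuous_on UNIV (U k) \<and> (\<forall>x. 0 \<le> U k x \<and> U k x \<le> \<beta> x)" for k
  proof (induction k)
    case 0
    then show ?case using \<beta>0 by (simp add: U0)
  next
    case (Suc k)
    have "continuous_on UNIV (U (Suc k))" unfolding US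
      by (intro continuous_intros contL continuous_on_integral_upper contg) (use Suc in auto)
    moreover have "0 \<le> U (Suc k) x" for x unfolding US
      by (intro mult_nonneg_nonneg integral_nonneg gint g_nonneg) (use Suc in auto)
    moreover have "U (Suc k) x \<le> \<beta> x" for x
    proof -
      have "U (Suc k) x \<le> exp (- L x) * (exp (L x) * \<beta> x)" unfolding US
        by (intro mult_left_mono g\<beta>) (use Suc in auto)
      then show ?thesis by (simp add: exp_minus mult.assoc[symmetric])
    qed
    ultimately show ?case by blast
  qed
  have U_Suc: "U k x \<le> U (Suc k) x" for k x
  proof (induction k arbitrary: x)
    case 0
    then show ?case using U_ok[of "Suc 0"] by (simp add: U0)
  next
    case (Suc k)
    have "integral {- real k..x} (\<lambda>y. g y (U k y)) \<le> integral {- real k..x} (\<lambda>y. g y (U (Suc k) y))"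
      by (intro integral_le gint g_mono) (use U_ok Suc in blast)+
    also have "\<dots> \<le> integral {- real (Suc k)..x} (\<lambda>y. g y (U (Suc k) y))"
      using U_ok[of "Suc k"] by (intro integral_subset_le gint ballI g_nonneg) auto
    finally have "integral {- real k..x} (\<lambda>y. g y (U k y))
      \<le> integral {- real (Suc k)..x} (\<lambda>y. g y (U (Suc k) y))" .
    then have "exp (- L x) * integral {- real k..x} (\<lambda>y. g y (U k y))
      \<le> exp (- L x) * integral {- real (Suc k)..x} (\<lambda>y. g y (U (Suc k) y))"
      by (rule mult_left_mono) simp
    then show ?case by (simp only: US)
  qed
  have "\<exists>l. (\<lambda>k. U k x) \<longlonglongrightarrow> l" for x
    using incseq_convergent[of "\<lambda>k. U k x" "\<beta> x"] U_Suc U_ok by (metis incseq_SucI)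
  then obtain u where u: "\<And>x. (\<lambda>k. U k x) \<longlonglongrightarrow> u x" by metis
  have u0: "0 \<le> u x" and u\<beta>: "u x \<le> \<beta> x" for x
    using U_ok LIMSEQ_le_const[OF u, of 0 x] LIMSEQ_le_const2[OF u, of x "\<beta> x"] by auto
  have lim_g: "(\<lambda>k. g y (U k y)) \<longlonglongrightarrow> g y (u y)" for y
  proof -
    have "continuous_on UNIV (\<lambda>v. g y v)" unfolding g_def
      by (intro continuous_intros continuous_on_compose2[OF contF, of _ "\<lambda>v. (y, v)", simplified])
    then show ?thesis using u[of y] continuous_on_tendsto_compose by fastforce
  qed
  have dom: "norm (g y (U k y)) \<le> g y (\<beta> y)" for k y
    using g_nonneg[of "U k y" y] g_mono[of "U k y" "\<beta> y" y] U_ok[of k] by auto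
  have int_u: "(\<lambda>y. g y (u y)) integrable_on {a..b}"
    and lim_int: "(\<lambda>k. integral {a..b} (\<lambda>y. g y (U k y))) \<longlonglongrightarrow> integral {a..b} (\<lambda>y. g y (u y))" for a b
    using dominated_convergence[of "\<lambda>k y. g y (U k y)" "{a..b}" "\<lambda>y. g y (\<beta> y)" "\<lambda>y. g y (u y)"]
      gint U_ok cont\<beta> dom lim_g by auto
  \<comment> \<open>Splitting at \<open>a\<close> packs everything to its left into the number
    \<open>u a\<close>, so the limit is taken over a fixed compact interval although the endpoint of
    the iteration recedes.\<close>
  have eq: "exp (L x) * u x = exp (L a) * u a + integral {a..x} (\<lambda>y. g y (u y))" if "a \<le> x" for a x
  proof (rule LIMSEQ_unique)
    show "(\<lambda>k. exp (L x) * U (Suc k) x) \<longlonglongrightarrow> exp (L x) * u x"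
      by (intro tendsto_intros LIMSEQ_Suc u)
    have "(\<lambda>k. exp (L a) * U (Suc k) a + integral {a..x} (\<lambda>y. g y (U k y)))
        \<longlonglongrightarrow> exp (L a) * u a + integral {a..x} (\<lambda>y. g y (u y))"
      by (intro tendsto_intros LIMSEQ_Suc u lim_int)
    moreover
    obtain k0 :: nat where k0: "- a \<le> real k0" using real_arch_simple by blast
    have "exp (L x) * U (Suc k) x = exp (L a) * U (Suc k) a + integral {a..x} (\<lambda>y. g y (U k y))"
      if "k0 \<le> k" for k
      unfolding US using Henstock_Kurzweil_Integration.integral_combine[of "- real k" a x "\<lambda>y. g y (U k y)"]
        \<open>a \<le> x\<close> k0 that gint U_ok by (simp add: exp_minus mult.assoc[symmetric])
    then have "\<forall>\<^sub>F k in sequentially. exp (L a) * U (Suc k) a + integral {a..x} (\<lambda>y. g y (U k y))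
        = exp (L x) * U (Suc k) x"
      unfolding eventually_sequentially by metis
    ultimately show "(\<lambda>k. exp (L x) * U (Suc k) x)
        \<longlonglongrightarrow> exp (L a) * u a + integral {a..x} (\<lambda>y. g y (u y))"
      by (rule Lim_transform_eventually)
  qed
  have u_eq: "u x = exp (- L x) * (exp (L a) * u a + integral {a..x} (\<lambda>y. g y (u y)))" if "a \<le> x" for a x
    using eq[OF that] by (simp add: exp_minus field_simps)
  have contu: "continuous_on {a..b} u" for a b
  proof -
    have "continuous_on {a..b} (\<lambda>x. exp (- L x) * (exp (L a) * u a + integral {a..x} (\<lambda>y. g y (u y))))"
      by (intro continuous_intros continuous_on_subset[OF contL] indefinite_integral_continuous_1 int_u) auto
    then show ?thesis by (rule continuous_on_eq) (use u_eq in auto)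
  qed
  have "(u has_real_derivative F x (u x)) (at x)" for x
  proof -
    have "((\<lambda>t. integral {x-1..t} (\<lambda>y. g y (u y))) has_real_derivative g x (u x)) (at x within {x-1..x+1})"
      by (rule integral_has_real_derivative) (use contg[OF contu] in auto)
    then have *: "((\<lambda>t. integral {x-1..t} (\<lambda>y. g y (u y))) has_real_derivative g x (u x)) (at x)"
      by (simp add: at_within_Icc_at)
    have "((\<lambda>t. exp (- L t) * (exp (L (x-1)) * u (x-1) + integral {x-1..t} (\<lambda>y. g y (u y))))
        has_real_derivative exp (- L x) * (g x (u x)) - l x * (exp (- L x) * (exp (L (x-1)) * u (x-1) + integral {x-1..x} (\<lambda>y. g y (u y))))) (at x)"
      by (rule derivative_eq_intros * L refl | simp add: algebra_simps)+
    moreover have "exp (- L x) * (g x (u x)) - l x * (exp (- L x) * (exp (L (x-1)) * u (x-1) + integral {x-1..x} (\<lambda>y. g y (u y)))) = F x (u x)"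
      using u_eq[of "x-1" x] unfolding g_def by (simp add: exp_minus mult.assoc[symmetric])
    ultimately have "((\<lambda>t. exp (- L t) * (exp (L (x-1)) * u (x-1) + integral {x-1..t} (\<lambda>y. g y (u y))))
        has_real_derivative F x (u x)) (at x)" by simp
    then show ?thesis
      by (rule has_field_derivative_transform_within_open[of _ _ _ "{x-1<..}"]) (auto intro!: u_eq[symmetric])
  qed
  then show ?thesis using that u0 u\<beta> by blast
qed

section \<open>The reduced first-order equation\<close>

text \<open>\<open>F\<close> is the right-hand side of the equation for \<open>u = (h + r r') / (r - h r')\<close> as a function of
  \<open>x = h / r\<close>: the equation of the theorem is invariant under dilations, and \<open>u\<close> is
  the ratio of the tangential and the normal component of the position vector. \<open>N\<close> stands for \<open>n\<close>.\<close>

locale expander_ode =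
  fixes N C :: real
  assumes N: "2 \<le> N" and NC: "1 < N * C"
begin

abbreviation "K \<equiv> N * C"
abbreviation "c \<equiv> (N - 1) * C"

lemma C_pos: "0 < C"
  using N NC by (smt (verit) mult_nonneg_nonpos)

lemma c_pos: "0 < c"
  using N C_pos by simp

definition F :: "real \<Rightarrow> real \<Rightarrow> real" where
  "F x u = (1 + u\<^sup>2) / (1 + x\<^sup>2) * (N + (N - 1) * u * x - (1 + u\<^sup>2) / C)"

text \<open>A supersolution. On the left it is the curve \<open>1 + x u = 0\<close>, on which \<open>r'\<close> is infinite;
  on the right \<open>F\<close> is nonpositive along it.\<close>

definition upper :: "real \<Rightarrow> real" where
  "upper x = 1 / max (- x) (1 / K) + c * max 0 x"

lemma one_plus_sq_pos: "0 < 1 + (x::real)\<^sup>2"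
  by (smt (verit) zero_le_power2)

lemma denominator_pos: "0 < max (- x) (1 / K)"
  using NC by (simp add: less_max_iff_disj)

lemma upper_left:
  assumes x: "x \<le> - 1 / K" shows "upper x = - 1 / x"
proof -
  have "- 1 / K < 0" using NC by simp
  then have "x < 0" using x by linarith
  then have "max (- x) (1 / K) = - x" "max 0 x = 0" using x by (simp_all add: max_def)
  then show ?thesis unfolding upper_def by simp
qed

lemma upper_right: "- 1 / K \<le> x \<Longrightarrow> upper x = K + c * max 0 x"
  using NC unfolding upper_def by (simp add: max_def)

lemma upper_le: "upper x \<le> K + c * max 0 x"
proof -
  have "1 / max (- x) (1 / K) \<le> 1 / (1 / K)"
    by (rule divide_left_mono) (use NC denominator_pos[of x] in auto)
  then show ?thesis unfolding upper_def by simp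
qed

lemma upper_nonneg: "0 \<le> upper x"
  using denominator_pos[of x] c_pos unfolding upper_def by (intro add_nonneg_nonneg) auto

lemma continuous_upper: "continuous_on UNIV upper"
  unfolding upper_def
  by (intro continuous_intros continuous_on_max) (use denominator_pos less_imp_neq in fastforce)

text \<open>The bound is the derivative of -1/x, so the hyperbola 1 + x u = 0 is a strict
  supersolution: on it the first factor of \<open>F\<close> collapses to
  \<open>1 / x\<^sup>2\<close> and the second is below 1. Strictness later keeps \<open>u\<close>
  off the hyperbola.\<close>

lemma F_at_reciprocal:
  assumes "x < 0" shows "F x (- 1 / x) < 1 / x\<^sup>2"
proof -
  have "F x (- 1 / x) = 1 / x\<^sup>2 * (1 - (1 + x\<^sup>2) / (x\<^sup>2 * C))"
  proof -
    have "1 + (- 1 / x)\<^sup>2 = (1 / x\<^sup>2) * (1 + x\<^sup>2)"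
      using assms by (simp add: field_simps)
    then have "(1 + (- 1 / x)\<^sup>2) / (1 + x\<^sup>2) = 1 / x\<^sup>2"
      using one_plus_sq_pos[of x] by simp
    moreover have "N + (N - 1) * (- 1 / x) * x - (1 + (- 1 / x)\<^sup>2) / C = 1 - (1 + x\<^sup>2) / (x\<^sup>2 * C)"
      using assms C_pos by (simp add: field_simps power2_eq_square)
    ultimately show ?thesis unfolding F_def by simp
  qed
  also have "\<dots> < 1 / x\<^sup>2 * 1"
    using assms C_pos one_plus_sq_pos[of x] by (intro mult_strict_left_mono) auto
  finally show ?thesis by simp
qed

lemma F_alt: "F x u = (1 + u\<^sup>2) / (1 + x\<^sup>2) * ((K + c * u * x - 1 - u\<^sup>2) / C)"
  unfolding F_def using C_pos by (simp add: field_simps)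

text \<open>The slope \<open>c\<close> is chosen so that c x - u <= - K; then c u x - u^2 <= - K u
  <= - K cancels the constant term. At x = -1/K the hyperbola has height \<open>K\<close>, so the
  branches of \<open>upper\<close> join.\<close>

lemma F_upper_right:
  assumes "- 1 / K \<le> x" shows "F x (K + c * max 0 x) \<le> 0"
proof -
  define u where "u = K + c * max 0 x"
  have u: "K \<le> u" unfolding u_def using c_pos by simp
  have "c * u * x - u\<^sup>2 \<le> - K * u"
  proof -
    have "u * (c * x - u) \<le> u * (- K)"
      by (rule mult_left_mono) (use u NC c_pos in \<open>auto simp: u_def max_def mult_nonneg_nonpos\<close>)
    then show ?thesis by (simp add: algebra_simps power2_eq_square)
  qed
  moreover have "K \<le> K * u" using u NC by (simp add: mult_le_cancel_left1)
  ultimately have "(K + c * u * x - 1 - u\<^sup>2) / C \<le> 0" using C_pos by (simp add: divide_le_0_iff)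
  then show ?thesis unfolding F_alt u_def[symmetric]
    using one_plus_sq_pos[of x] one_plus_sq_pos[of u] by (intro mult_nonneg_nonpos) auto
qed

text \<open>After division by v - u a cubic \<open>Q\<close> remains. Its nonnegative term
  \<open>N * (u + v)\<close> is dropped, the factor \<open>x\<close> is absorbed by
  \<open>1 + x\<^sup>2\<close>, and b >= 1 lets \<open>b ^ 3\<close> dominate all powers; 4 and 8
  count the terms so bounded.\<close>

lemma F_one_sided_lipschitz:
  assumes "0 \<le> u" "u \<le> v" "v \<le> b" "1 \<le> b"
  shows "F x u - F x v \<le> (4 * (N - 1) + 8 / C) * b ^ 3 * (v - u)"
proof -
  define Q where "Q = N * (u + v) + (N - 1) * x * (1 + u\<^sup>2 + u * v + v\<^sup>2)
    - (2 * (u + v) + (u + v) * (u\<^sup>2 + v\<^sup>2)) / C"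
  define M where "M = (4 * (N - 1) + 8 / C) * b ^ 3"
  have eq: "(F x v - F x u) * (1 + x\<^sup>2) = (v - u) * Q"
  proof -
    have "F x w * (1 + x\<^sup>2) = (1 + w\<^sup>2) * (N + (N - 1) * w * x - (1 + w\<^sup>2) / C)" for w
      using one_plus_sq_pos[of x] unfolding F_def by simp
    moreover have "(1 + v\<^sup>2) * (N + (N - 1) * v * x - (1 + v\<^sup>2) * i)
        - (1 + u\<^sup>2) * (N + (N - 1) * u * x - (1 + u\<^sup>2) * i)
        = (v - u) * (N * (u + v) + (N - 1) * x * (1 + u\<^sup>2 + u * v + v\<^sup>2)
          - (2 * (u + v) + (u + v) * (u\<^sup>2 + v\<^sup>2)) * i)" for i
      by algebra
    ultimately show ?thesis unfolding Q_def left_diff_distrib[of "F x v"] by (simp add: divide_inverse)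
  qed
  have b2: "u\<^sup>2 \<le> b\<^sup>2" "v\<^sup>2 \<le> b\<^sup>2" "u * v \<le> b\<^sup>2"
    using assms by (auto intro!: power_mono simp: power2_eq_square intro: mult_mono)
  have b3: "b\<^sup>2 \<le> b ^ 3" "b \<le> b ^ 3" "1 \<le> b ^ 3"
    using assms power_increasing[of 2 3 b] power_increasing[of 1 3 b] by auto
  have x1: "\<bar>x\<bar> \<le> 1 + x\<^sup>2"
    using sum_squares_bound[of "\<bar>x\<bar>" 1] by (simp)
  have 1: "- ((N - 1) * x * (1 + u\<^sup>2 + u * v + v\<^sup>2)) \<le> (1 + x\<^sup>2) * ((N - 1) * (4 * b ^ 3))"
  proof -
    have "- ((N - 1) * x * (1 + u\<^sup>2 + u * v + v\<^sup>2)) \<le> \<bar>x\<bar> * ((N - 1) * (1 + u\<^sup>2 + u * v + v\<^sup>2))"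
      using N assms by (simp add: abs_if mult.assoc mult.left_commute)
    also have "\<dots> \<le> (1 + x\<^sup>2) * ((N - 1) * (4 * b ^ 3))"
    proof (intro mult_mono x1)
      show "1 + u\<^sup>2 + u * v + v\<^sup>2 \<le> 4 * b ^ 3" using b2 b3 by linarith
    qed (use N assms in auto)
    finally show ?thesis .
  qed
  have 2: "(2 * (u + v) + (u + v) * (u\<^sup>2 + v\<^sup>2)) / C \<le> (1 + x\<^sup>2) * (8 / C * b ^ 3)"
  proof -
    have "(u + v) * (u\<^sup>2 + v\<^sup>2) \<le> (2 * b) * (2 * b\<^sup>2)"
      by (intro mult_mono) (use assms add_mono[OF b2(1,2)] in simp_all)
    then have "2 * (u + v) + (u + v) * (u\<^sup>2 + v\<^sup>2) \<le> 8 * b ^ 3"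
    proof -
      have "b * b\<^sup>2 = b ^ 3" by (simp add: power3_eq_cube power2_eq_square)
      moreover have "u \<le> b ^ 3" "v \<le> b ^ 3" using assms b3 by linarith+
      ultimately show ?thesis using \<open>(u + v) * (u\<^sup>2 + v\<^sup>2) \<le> (2 * b) * (2 * b\<^sup>2)\<close> by simp
    qed
    then have "(2 * (u + v) + (u + v) * (u\<^sup>2 + v\<^sup>2)) / C \<le> 1 * (8 / C * b ^ 3)"
      using C_pos by (simp add: divide_right_mono)
    also have "\<dots> \<le> (1 + x\<^sup>2) * (8 / C * b ^ 3)"
      using C_pos assms by (intro mult_right_mono) auto
    finally show ?thesis .
  qed
  have "- Q \<le> (1 + x\<^sup>2) * M"
  proof -
    have "(1 + x\<^sup>2) * M = (1 + x\<^sup>2) * ((N - 1) * (4 * b ^ 3)) + (1 + x\<^sup>2) * (8 / C * b ^ 3)"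
      unfolding M_def by (simp add: algebra_simps)
    moreover have "0 \<le> N * (u + v)" using N assms by simp
    ultimately show ?thesis using 1 2 unfolding Q_def by linarith
  qed
  then have "(v - u) * (- Q) \<le> (v - u) * ((1 + x\<^sup>2) * M)"
    using assms by (intro mult_left_mono) auto
  then have "(F x u - F x v) * (1 + x\<^sup>2) \<le> (M * (v - u)) * (1 + x\<^sup>2)"
    using eq by (simp add: algebra_simps)
  then show ?thesis using one_plus_sq_pos[of x] unfolding M_def[symmetric]
    by (simp add: mult_le_cancel_right)
qed

lemma solution_exists:
  obtains u where "\<And>x. (u has_real_derivative F x (u x)) (at x)"
    "\<And>x. 0 \<le> u x" "\<And>x. u x \<le> upper x"
proof -
  define B where "B = (4 * (N - 1) + 8 / C) * (K + c) ^ 3"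
  have "0 \<le> B" unfolding B_def using N NC C_pos c_pos by simp
  \<comment> \<open>For x >= 0 the bound K + c x is at most (K + c) exp x, whose cube produces
    \<open>exp (3 * x)\<close>; the summand 1 serves x <= 0. This majorant has the explicit
    antiderivative \<open>L\<close>.\<close>
  define l where "l x = B * (1 + exp (3 * x))" for x
  define L where "L x = B * (x + exp (3 * x) / 3)" for x :: real
  \<comment> \<open>At the kinks -1/K and 0 the right-hand derivative is taken, since
    \<open>super\<close> is demanded there too.\<close>
  define \<beta>' where "\<beta>' x = (if x < - 1 / K then 1 / x\<^sup>2 else if x < 0 then 0 else c)" for x
  have cubic: "(4 * (N - 1) + 8 / C) * (K + c * max 0 x) ^ 3 \<le> l x" for x
  proof -
    have "c * max 0 x + K \<le> (K + c) * (1 + max 0 x)"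
    proof -
      have "0 \<le> K * max 0 x" using N C_pos by (intro mult_nonneg_nonneg) auto
      moreover have "(K + c) * (1 + max 0 x) = K + c + K * max 0 x + c * max 0 x" by algebra
      ultimately show ?thesis using c_pos by linarith
    qed
    also have "\<dots> \<le> (K + c) * exp (max 0 x)"
      using NC c_pos exp_ge_add_one_self by (intro mult_left_mono) auto
    finally have "(K + c * max 0 x) ^ 3 \<le> ((K + c) * exp (max 0 x)) ^ 3"
      using NC c_pos by (intro power_mono) auto
    also have "\<dots> = (K + c) ^ 3 * exp (3 * max 0 x)"
      by (simp add: power_mult_distrib exp_of_nat_mult[symmetric])
    also have "\<dots> \<le> (K + c) ^ 3 * (1 + exp (3 * x))"
      using NC c_pos by (intro mult_left_mono) (auto simp: max_def)
    finally have "(4 * (N - 1) + 8 / C) * (K + c * max 0 x) ^ 3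
        \<le> (4 * (N - 1) + 8 / C) * ((K + c) ^ 3 * (1 + exp (3 * x)))"
      using N C_pos by (intro mult_left_mono) auto
    then show ?thesis unfolding l_def B_def by (simp add: mult.assoc)
  qed
  have contF: "continuous_on UNIV (\<lambda>z. F (fst z) (snd z))"
    unfolding F_def
    by (intro continuous_intros) (use one_plus_sq_pos C_pos in \<open>auto simp: less_imp_neq[symmetric]\<close>)
  have L: "(L has_real_derivative l x) (at x)" for x
    unfolding L_def l_def by (auto intro!: derivative_eq_intros simp: algebra_simps)
  have contl: "continuous_on UNIV l" unfolding l_def by (intro continuous_intros)
  have F0: "0 \<le> F x 0" for x
    unfolding F_def using NC C_pos one_plus_sq_pos[of x] by (simp add: field_simps)
  have d\<beta>: "(upper has_real_derivative \<beta>' x) (at x)" if "x \<notin> {- 1 / K, 0}" for x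
  proof -
    have "x < - 1 / K \<or> - 1 / K < x" "x < 0 \<or> 0 < x"
      using that linorder_neqE by blast+
    then consider "x < - 1 / K" | "- 1 / K < x" "x < 0" | "0 < x" by blast
    then show ?thesis
    proof cases
      case 1
      have "- 1 / K < 0" using NC by simp
      then have "((\<lambda>x. - 1 / x) has_real_derivative \<beta>' x) (at x)"
        using 1 unfolding \<beta>'_def by (auto intro!: derivative_eq_intros simp: power2_eq_square)
      then show ?thesis
        by (rule has_field_derivative_transform_within_open[of _ _ _ "{..<- 1 / K}"])
          (use 1 in \<open>auto simp: upper_left\<close>)
    next
      case 2
      have "((\<lambda>x. K) has_real_derivative \<beta>' x) (at x)"
        using 2 unfolding \<beta>'_def by auto
      then show ?thesis
        by (rule has_field_derivative_transform_within_open[of _ _ _ "{- 1 / K<..<0}"])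
          (use 2 in \<open>auto simp: upper_right max_def\<close>)
    next
      case 3
      have "- 1 / K < 0" using NC by simp
      then have neg: "- 1 / K < x" "\<not> x < - 1 / K" using 3 by linarith+
      have der: "((\<lambda>x. K + c * x) has_real_derivative \<beta>' x) (at x)"
        using 3 neg unfolding \<beta>'_def by (auto intro!: derivative_eq_intros)
      have up: "K + c * y = upper y" if "0 < y" for y
      proof -
        have "- 1 / K \<le> y" using \<open>- 1 / K < 0\<close> that by linarith
        then show ?thesis using upper_right[of y] that by (simp add: max_def)
      qed
      show ?thesis
        by (rule has_field_derivative_transform_within_open[OF der, of "{0<..}"]) (use 3 up in auto)
    qed
  qed
  have super: "F x (upper x) \<le> \<beta>' x" for x
  proof (cases "x < - 1 / K")
    case True
    moreover have "- 1 / K < 0" using NC by simp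
    ultimately have "x < 0" by linarith
    then show ?thesis
      using F_at_reciprocal[of x] upper_left[of x] True unfolding \<beta>'_def by simp
  next
    case False
    then have "F x (upper x) \<le> 0" using F_upper_right[of x] upper_right[of x] by simp
    then show ?thesis using False c_pos unfolding \<beta>'_def by auto
  qed
  have mono: "F x u + l x * u \<le> F x v + l x * v" if "0 \<le> u" "u \<le> v" "v \<le> upper x" for x u v
  proof -
    have "1 \<le> K + c * max 0 x" using NC c_pos by (simp add: add_increasing2)
    then have "F x u - F x v \<le> (4 * (N - 1) + 8 / C) * (K + c * max 0 x) ^ 3 * (v - u)"
      using that upper_le[of x] by (intro F_one_sided_lipschitz) auto
    also have "\<dots> \<le> l x * (v - u)" using cubic that by (intro mult_right_mono) auto
    finally show ?thesis by (simp add: algebra_simps)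
  qed
  have "finite {- 1 / K, 0}" by simp
  show ?thesis
  proof (rule monotone_iteration_solution[OF contF L contl F0 \<open>finite {- 1 / K, 0}\<close> continuous_upper])
    fix u assume "\<And>x. (u has_real_derivative F x (u x)) (at x)"
      "\<And>x. 0 \<le> u x" "\<And>x. u x \<le> upper x"
    then show ?thesis by (rule that)
  qed (rule d\<beta> super upper_nonneg mono; assumption)+
qed

end

section \<open>Barriers for the reduced solution\<close>

text \<open>\<open>J\<close> is the logarithm of the distance to the origin, normalised by its value \<open>\<bar>h0\<bar>\<close> on the axis.\<close>

locale expander_profile = expander_ode +
  fixes u J :: "real \<Rightarrow> real" and h0 :: real
  assumes u_deriv: "\<And>x. (u has_real_derivative F x (u x)) (at x)"
    and u_nonneg: "\<And>x. 0 \<le> u x" and u_upper: "\<And>x. u x \<le> upper x"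
    and J_deriv: "\<And>x. (J has_real_derivative u x / (1 + x\<^sup>2)) (at x)"
    and J_lim: "(J \<longlongrightarrow> 0) at_bot" and h0: "h0 < 0"
begin

lemma u_pos: "0 < u x"
proof (rule stays_positive[of "x - 1" x u "\<lambda>x. F x (u x)"])
  fix y assume "u y = 0"
  then show "0 < F y (u y)"
    unfolding F_alt using NC C_pos one_plus_sq_pos[of y] by simp
qed (use u_deriv u_nonneg in auto)

text \<open>On the far left \<open>upper\<close> gives the weak inequality, and the strict barrier
  makes it strict. This quantity carries the sign of dh/dx, so its positivity makes the curve a
  graph over \<open>h\<close>.\<close>

lemma one_plus_pos: "0 < 1 + x * u x"
proof (cases "0 \<le> x")
  case True
  then show ?thesis using u_nonneg[of x] by (simp add: add_pos_nonneg)
next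
  case False
  define a where "a = min (x - 1) (- 1 / K)"
  have a: "a < x" "a \<le> - 1 / K" unfolding a_def by auto
  then have "a < 0" using False by simp
  show ?thesis
  proof (rule stays_positive[of a x "\<lambda>x. 1 + x * u x" "\<lambda>x. u x + x * F x (u x)"])
    show "0 \<le> 1 + a * u a"
      using u_upper[of a] upper_left[OF a(2)] \<open>a < 0\<close> by (simp add: field_simps)
    fix y assume y: "a \<le> y" "y \<le> x" "1 + y * u y = 0"
    then have "y < 0" using False by simp
    then have uy: "u y = - 1 / y" using y by (simp add: field_simps)
    have "y * (1 / y\<^sup>2) < y * F y (u y)"
      using F_at_reciprocal[OF \<open>y < 0\<close>] \<open>y < 0\<close> uy by (intro mult_strict_left_mono_neg) auto
    then show "0 < u y + y * F y (u y)" using \<open>y < 0\<close> uy by (simp add: power2_eq_square)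
  qed (auto intro!: derivative_eq_intros u_deriv simp: a)
qed

lemma u_le: "u x \<le> K + c * max 0 x"
  using u_upper[of x] upper_le[of x] by linarith

text \<open>\<open>p\<close> is \<open>r'\<close> as a function of \<open>x\<close>, and \<open>G\<close> has the sign of \<open>r''\<close>.\<close>

definition G :: "real \<Rightarrow> real" where "G x = c * (1 + x * u x) - (1 + (u x)\<^sup>2)"

definition p :: "real \<Rightarrow> real" where "p x = (u x - x) / (1 + x * u x)"

lemma F_G: "F x (u x) = (1 + (u x)\<^sup>2) / (1 + x\<^sup>2) * (1 + G x / C)"
  unfolding F_def G_def using C_pos by (simp add: field_simps)

lemma G_deriv: "(G has_real_derivative c * (u x + x * F x (u x)) - 2 * u x * F x (u x)) (at x)"
  unfolding G_def by (auto intro!: derivative_eq_intros u_deriv)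

text \<open>Where \<open>G\<close> vanishes, \<open>F\<close> is the slope belonging to a straight
  line and c (1 + x u) may be replaced by 1 + u^2; this eliminates \<open>c\<close> and leaves the
  sign to x - u.\<close>

lemma G_deriv_at_zero:
  assumes "G x = 0"
  shows "c * (u x + x * F x (u x)) - 2 * u x * F x (u x) = (1 + (u x)\<^sup>2) * (x - u x) / (1 + x\<^sup>2)"
proof -
  have "c * (1 + x * u x) = 1 + (u x)\<^sup>2" using assms unfolding G_def by simp
  moreover have F: "F x (u x) = (1 + (u x)\<^sup>2) / (1 + x\<^sup>2)" using F_G[of x] assms by simp
  ultimately have "(c * (u x + x * F x (u x)) - 2 * u x * F x (u x)) * (1 + x\<^sup>2)
      = c * (u x) * (1 + x\<^sup>2) + (c * x - 2 * u x) * (1 + (u x)\<^sup>2)"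
    using one_plus_sq_pos[of x] by (simp add: field_simps)
  also have "\<dots> = c * (1 + x * u x) * (u x + x) - 2 * u x * (1 + (u x)\<^sup>2)" by algebra
  also have "\<dots> = (1 + (u x)\<^sup>2) * (x - u x)"
    unfolding \<open>c * (1 + x * u x) = 1 + (u x)\<^sup>2\<close> by algebra
  finally show ?thesis using one_plus_sq_pos[of x] by (simp add: field_simps)
qed

lemma p_deriv: "(p has_real_derivative (1 + (u x)\<^sup>2) * G x / (C * (1 + x * u x)\<^sup>2)) (at x)"
proof -
  have "(p has_real_derivative
      ((F x (u x) - 1) * (1 + x * u x) - (u x - x) * (u x + x * F x (u x))) / (1 + x * u x)\<^sup>2) (at x)"
    unfolding p_def using one_plus_pos[of x]
    by (auto intro!: derivative_eq_intros u_deriv simp: power2_eq_square)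
  moreover have "(F x (u x) - 1) * (1 + x * u x) - (u x - x) * (u x + x * F x (u x))
      = F x (u x) * (1 + x\<^sup>2) - (1 + (u x)\<^sup>2)" by algebra
  moreover have "F x (u x) * (1 + x\<^sup>2) - (1 + (u x)\<^sup>2) = (1 + (u x)\<^sup>2) * G x / C"
  proof -
    have "F x (u x) * (1 + x\<^sup>2) = (1 + (u x)\<^sup>2) * (1 + G x / C)"
      using one_plus_sq_pos[of x] unfolding F_G by simp
    then show ?thesis by (simp add: distrib_left)
  qed
  ultimately show ?thesis by simp
qed

text \<open>For x <= 0 the denominator lies in (0, 1], so dividing by it can only enlarge u - x >= -
  x.\<close>

lemma p_ge: "x \<le> 0 \<Longrightarrow> - x \<le> p x"
proof -
  assume x: "x \<le> 0"
  have "(u x - x) * (1 + x * u x) \<le> (u x - x) * 1"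
    using x u_nonneg[of x] by (intro mult_left_mono) (auto simp: mult_nonpos_nonneg)
  then have "u x - x \<le> p x" unfolding p_def using one_plus_pos[of x] by (simp add: field_simps)
  then show ?thesis using u_nonneg[of x] by simp
qed

text \<open>If \<open>G\<close> were nonnegative somewhere on the left, it would be positive further to the left,
  and the slope would be increasing there although it tends to \<open>\<infinity>\<close> at \<open>-\<infinity>\<close>.\<close>

lemma G_neg_left:
  assumes "x0 \<le> 0" shows "G x0 < 0"
proof (rule ccontr)
  assume n: "\<not> G x0 < 0"
  \<comment> \<open>A zero of \<open>G\<close> on x <= 0 is crossed downwards, since x < u there; a
    negative value could not recover to G x0 >= 0.\<close>
  have "0 \<le> G y" if "y \<le> x0" for y
  proof (rule ccontr)
    assume neg: "\<not> 0 \<le> G y"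
    then have "y < x0" using n that by (cases "y = x0") auto
    have "0 < - G x0"
    proof (rule stays_positive[of y x0 "\<lambda>x. - G x" "\<lambda>x. - (c * (u x + x * F x (u x)) - 2 * u x * F x (u x))"])
      fix z assume z: "y \<le> z" "z \<le> x0" "- G z = 0"
      have "(1 + (u z)\<^sup>2) * (z - u z) / (1 + z\<^sup>2) < 0"
        using z assms u_pos[of z] one_plus_sq_pos[of z] one_plus_sq_pos[of "u z"]
        by (intro divide_neg_pos mult_pos_neg) auto
      then show "0 < - (c * (u z + z * F z (u z)) - 2 * u z * F z (u z))"
        using G_deriv_at_zero[of z] z by simp
    qed (use \<open>y < x0\<close> neg in \<open>auto intro!: derivative_eq_intros G_deriv\<close>)
    then show False using n by simp
  qed
  then have Gnn: "0 \<le> G y" if "y \<le> x0" for y using that by blast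
  have inc: "p y \<le> p x0" if "y \<le> x0" for y
  proof (rule DERIV_nonneg_imp_nondecreasing[OF that])
    fix z assume "y \<le> z" "z \<le> x0"
    then have "0 \<le> (1 + (u z)\<^sup>2) * G z / (C * (1 + z * u z)\<^sup>2)"
      using Gnn[of z] C_pos by simp
    then show "\<exists>d. (p has_real_derivative d) (at z) \<and> 0 \<le> d" using p_deriv by blast
  qed
  \<comment> \<open>Chosen with - y > p x0, against - y <= p y <= p x0.\<close>
  define y where "y = min x0 (- \<bar>p x0\<bar> - 1)"
  have "y \<le> x0" "y \<le> 0" unfolding y_def by auto
  then have "- y \<le> p x0" using inc[of y] p_ge[of y] by simp
  then show False unfolding y_def by linarith
qed

text \<open>A line of small slope is a strict subsolution for every admissible \<open>C\<close>; any
  positive slope makes the height \<open>H\<close> unbounded.\<close>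

lemma u_gt_linear: obtains \<epsilon> where "0 < \<epsilon>" "\<And>x. 0 \<le> x \<Longrightarrow> \<epsilon> * x < u x"
proof -
  define \<delta> where "\<delta> = N - 1 / C"
  have \<delta>: "0 < \<delta>" unfolding \<delta>_def using NC C_pos by (simp add: field_simps)
  \<comment> \<open>\<open>i\<close> is 1/\<epsilon>. With y = (\<epsilon> x)^2 the barrier
    condition is positivity of a quadratic in \<open>y\<close>: \<open>1 / C\<close> offsets the
    -1/C in its leading coefficient, \<open>1 / (C\<^sup>2 * \<delta>)\<close> completes the square,
    and \<open>2 / \<delta>\<close> forces \<epsilon> <= \<delta>/2.\<close>
  define i where "i = 1 / C + 1 / (C\<^sup>2 * \<delta>) + 2 / \<delta>"
  define \<epsilon> where "\<epsilon> = 1 / i"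
  have i: "0 < i" unfolding i_def using C_pos \<delta> by (intro add_pos_pos) auto
  then have \<epsilon>: "0 < \<epsilon>" unfolding \<epsilon>_def by simp
  have "2 / \<delta> \<le> i" unfolding i_def using C_pos \<delta> by simp
  then have \<epsilon>\<delta>: "\<epsilon> \<le> \<delta> / 2" unfolding \<epsilon>_def using i \<delta> by (simp add: field_simps)
  have barrier: "\<epsilon> < F x (\<epsilon> * x)" for x
  proof -
    define y where "y = \<epsilon>\<^sup>2 * x\<^sup>2"
    have y: "0 \<le> y" unfolding y_def by simp
    have x2: "\<epsilon> * x\<^sup>2 = i * y" unfolding y_def \<epsilon>_def using i by (simp add: power2_eq_square)
    have "0 < \<delta> / 2 - y / C + (i - 1 / C) * y\<^sup>2"
    proof -
      have "0 \<le> \<delta> / 4 * (1 - 2 * y / (C * \<delta>))\<^sup>2" using \<delta> by simp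
      also have "\<dots> = \<delta> / 4 - y / C + 1 / (C\<^sup>2 * \<delta>) * y\<^sup>2"
        using \<delta> C_pos by (simp add: field_simps power2_eq_square)
      also have "\<dots> \<le> \<delta> / 4 - y / C + (i - 1 / C) * y\<^sup>2"
      proof -
        have "1 / (C\<^sup>2 * \<delta>) \<le> i - 1 / C" unfolding i_def using \<delta> by simp
        from mult_right_mono[OF this, of "y\<^sup>2"] show ?thesis by simp
      qed
      finally show ?thesis using \<delta> by linarith
    qed
    moreover have "0 \<le> y * \<delta>" using y \<delta> by simp
    ultimately have "\<epsilon> < \<delta> - y / C + (i - 1 / C) * y\<^sup>2 + y * \<delta>" using \<epsilon>\<delta> by linarith
    then have "\<epsilon> + \<epsilon> * x\<^sup>2 < (1 + y) * (\<delta> + \<epsilon> * x\<^sup>2 - y / C)"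
      unfolding x2 by (simp add: algebra_simps power2_eq_square add_divide_distrib)
    also have "\<dots> \<le> (1 + y) * (\<delta> + (N - 1) * (\<epsilon> * x\<^sup>2) - y / C)"
    proof (intro mult_left_mono)
      have "1 * (\<epsilon> * x\<^sup>2) \<le> (N - 1) * (\<epsilon> * x\<^sup>2)" using N \<epsilon> by (intro mult_right_mono) auto
      then show "\<delta> + \<epsilon> * x\<^sup>2 - y / C \<le> \<delta> + (N - 1) * (\<epsilon> * x\<^sup>2) - y / C" by simp
    qed (use y in auto)
    also have "\<delta> + (N - 1) * (\<epsilon> * x\<^sup>2) - y / C = N + (N - 1) * (\<epsilon> * x) * x - (1 + (\<epsilon> * x)\<^sup>2) / C"
      unfolding \<delta>_def y_def by (simp add: add_divide_distrib power_mult_distrib power2_eq_square)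
    also have "(1 + y) * (N + (N - 1) * (\<epsilon> * x) * x - (1 + (\<epsilon> * x)\<^sup>2) / C) = F x (\<epsilon> * x) * (1 + x\<^sup>2)"
      using one_plus_sq_pos[of x] unfolding F_def y_def power_mult_distrib by simp
    finally have "\<epsilon> * (1 + x\<^sup>2) < F x (\<epsilon> * x) * (1 + x\<^sup>2)" by (simp add: distrib_left)
    then show ?thesis using one_plus_sq_pos[of x] by (simp add: mult_less_cancel_right_pos)
  qed
  have "0 < u x - \<epsilon> * x" if "0 \<le> x" for x
  proof (cases "x = 0")
    case False
    show ?thesis
    proof (rule stays_positive[of 0 x _ "\<lambda>x. F x (u x) - \<epsilon>"])
      fix y assume "u y - \<epsilon> * y = 0"
      then have "u y = \<epsilon> * y" by simp
      then show "0 < F y (u y) - \<epsilon>" using barrier[of y] by simp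
    qed (use False that u_nonneg in \<open>auto intro!: derivative_eq_intros u_deriv\<close>)
  qed (use u_pos in auto)
  then show ?thesis using that[OF \<epsilon>] by simp
qed

lemma u_gt_super:
  assumes "1 < c"
  obtains m where "1 < m" "\<And>x. 0 \<le> x \<Longrightarrow> m * x < u x"
proof -
  \<comment> \<open>m <= c keeps the x^2 term of the bracket nonnegative, m < 1 + (c - 1)/C puts
    \<open>m\<close> below the bracket at x = 0, and m > 1 makes the prefactor at least 1.\<close>
  define m where "m = 1 + min (c - 1) ((c - 1) / (2 * C))"
  have m: "1 < m" "m \<le> c" unfolding m_def using assms C_pos by auto
  define s where "s = (c - 1) / C"
  have "m - 1 \<le> s / 2" unfolding m_def s_def by simp
  moreover have "0 < s" unfolding s_def using assms C_pos by (intro divide_pos_pos) auto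
  ultimately have "m < 1 + s" by linarith
  then have mC: "m < 1 + (c - 1) / C" unfolding s_def .
  have barrier: "m < F x (m * x)" for x
  proof -
    have "1 * x\<^sup>2 \<le> m\<^sup>2 * x\<^sup>2" using m by (intro mult_right_mono) auto
    then have r: "1 \<le> (1 + (m * x)\<^sup>2) / (1 + x\<^sup>2)"
      using one_plus_sq_pos[of x] by (simp add: power_mult_distrib)
    have "0 \<le> m * (c - m) * x\<^sup>2" using m by simp
    then have "0 \<le> (m * (c - m) * x\<^sup>2) / C" using C_pos by simp
    moreover have "(K + c * (m * x) * x - 1 - (m * x)\<^sup>2) / C = 1 + (c - 1) / C + (m * (c - m) * x\<^sup>2) / C"
      using C_pos by (simp add: field_simps power2_eq_square)
    ultimately have b: "m < (K + c * (m * x) * x - 1 - (m * x)\<^sup>2) / C" using mC by linarith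
    then have "1 * ((K + c * (m * x) * x - 1 - (m * x)\<^sup>2) / C) \<le> F x (m * x)"
      unfolding F_alt using r m by (intro mult_right_mono) auto
    then show ?thesis using b by linarith
  qed
  have "0 < u x - m * x" if "0 \<le> x" for x
  proof (cases "x = 0")
    case False
    show ?thesis
    proof (rule stays_positive[of 0 x _ "\<lambda>x. F x (u x) - m"])
      fix y assume "u y - m * y = 0"
      then have "u y = m * y" by simp
      then show "0 < F y (u y) - m" using barrier[of y] by simp
    qed (use False that u_nonneg in \<open>auto intro!: derivative_eq_intros u_deriv\<close>)
  qed (use u_pos in auto)
  then show ?thesis using that[OF m(1)] by simp
qed

text \<open>For \<open>c = 1\<close> the identity is itself a solution, and the difference of two solutions of an
  ODE with polynomial right-hand side satisfies a linear homogeneous equation.\<close>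

lemma u_gt_critical:
  assumes "c = 1"
  shows "x < u x"
proof -
  \<comment> \<open>The identity is the cylinder with \<open>r\<close> constant. \<open>q\<close> is
    (F - 1)/(u - y) after cancellation, hence continuous even where u - y would vanish.\<close>
  define q where "q y = ((u y + y) - (1 + (u y)\<^sup>2) * u y / C) / (1 + y\<^sup>2)" for y
  have contu: "continuous_on UNIV u"
    using u_deriv by (intro continuous_at_imp_continuous_on) (auto intro: DERIV_isCont)
  have "continuous_on UNIV q" unfolding q_def
    by (intro continuous_intros contu) (use one_plus_sq_pos C_pos in \<open>auto simp: less_imp_neq[symmetric]\<close>)
  then obtain Q where Q: "\<And>y. (Q has_real_derivative q y) (at y)"
    using antiderivative_exists by blast
  have lin: "F y (u y) - 1 = q y * (u y - y)" for y
  proof -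
    have G: "G y = - (u y) * (u y - y)" unfolding G_def assms by algebra
    have "(F y (u y) - 1) * (1 + y\<^sup>2) = (1 + (u y)\<^sup>2) * (1 + G y / C) - (1 + y\<^sup>2)"
      unfolding F_G using one_plus_sq_pos[of y] by (simp add: left_diff_distrib)
    also have "\<dots> = (u y - y) * ((u y + y) - (1 + (u y)\<^sup>2) * u y / C)"
      unfolding G by (simp add: divide_inverse) algebra
    finally show ?thesis unfolding q_def using one_plus_sq_pos[of y]
      by (simp add: field_simps)
  qed
  have "((\<lambda>y. exp (- Q y) * (u y - y)) has_real_derivative 0) (at y)" for y
    using exp_integrating_factor[of "\<lambda>y. - Q y" "\<lambda>y. - q y" y "\<lambda>y. u y - y" "F y (u y) - 1"] lin[of y]
    by (auto intro!: derivative_eq_intros u_deriv Q)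
  then have "exp (- Q x) * (u x - x) = exp (- Q 0) * (u 0 - 0)"
    by (intro DERIV_isconst_all[of "\<lambda>y. exp (- Q y) * (u y - y)"] allI)
  then have "0 < exp (- Q x) * (u x - x)" using u_pos[of 0] by simp
  then show ?thesis by (simp add: zero_less_mult_iff)
qed

end

lemma mono_bounded_tendsto_at_top:
  fixes f :: "real \<Rightarrow> real"
  assumes "mono f" and bd: "\<And>x. f x \<le> B"
  obtains l where "(f \<longlongrightarrow> l) at_top" "\<And>x. f x \<le> l"
proof -
  have bdd: "bdd_above (range f)" using bd by (rule bdd_aboveI2)
  have le: "f x \<le> Sup (range f)" for x using bdd by (intro cSup_upper) auto
  have "(f \<longlongrightarrow> Sup (range f)) at_top"
  proof (rule order_tendstoI)
    fix a assume "a < Sup (range f)"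
    then obtain x where "a < f x" using less_cSup_iff[OF _ bdd] by auto
    then have "\<forall>y\<ge>x. a < f y" using \<open>mono f\<close> by (meson less_le_trans monoD)
    then show "\<forall>\<^sub>F y in at_top. a < f y" unfolding eventually_at_top_linorder by blast
  next
    fix a assume "Sup (range f) < a"
    then show "\<forall>\<^sub>F y in at_top. f y < a" using le le_less_trans by (intro always_eventually allI) blast
  qed
  then show ?thesis using that le by blast
qed

section \<open>The profile curve\<close>

context expander_profile
begin

definition R :: "real \<Rightarrow> real" where "R x = - h0 * exp (J x - ln (1 + x\<^sup>2) / 2)"

definition H :: "real \<Rightarrow> real" where "H x = x * R x"

lemma R_pos: "0 < R x"
  unfolding R_def using h0 by (intro mult_pos_pos) auto

lemma ln_deriv: "((\<lambda>x. ln (1 + x\<^sup>2)) has_real_derivative 2 * x / (1 + x\<^sup>2)) (at (x::real))"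
  using one_plus_sq_pos[of x] by (auto intro!: derivative_eq_intros)

lemma R_deriv: "(R has_real_derivative R x * (u x - x) / (1 + x\<^sup>2)) (at x)"
proof -
  have "(R has_real_derivative R x * (u x / (1 + x\<^sup>2) - 2 * x / (1 + x\<^sup>2) / 2)) (at x)"
    using DERIV_cmult[OF DERIV_fun_exp[OF DERIV_diff[OF J_deriv DERIV_cdivide[OF ln_deriv, of 2]]], of "- h0" x]
    unfolding R_def[abs_def] mult.assoc .
  moreover have "R x * (u x / (1 + x\<^sup>2) - 2 * x / (1 + x\<^sup>2) / 2) = R x * (u x - x) / (1 + x\<^sup>2)"
  proof -
    have "2 * x / d / 2 = x / d" for d :: real by simp
    then show ?thesis by (simp only: diff_divide_distrib[symmetric] times_divide_eq_right)
  qed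
  ultimately show ?thesis by simp
qed

lemma R_eq: "R x = - h0 * exp (J x) * exp (- ln (1 + x\<^sup>2) / 2)"
  unfolding R_def mult.assoc exp_add[symmetric] by simp

lemma H_deriv: "(H has_real_derivative R x * (1 + x * u x) / (1 + x\<^sup>2)) (at x)"
proof -
  have "(H has_real_derivative R x + x * (R x * (u x - x) / (1 + x\<^sup>2))) (at x)"
    unfolding H_def by (auto intro!: derivative_eq_intros R_deriv)
  moreover have "R x + x * (R x * (u x - x) / (1 + x\<^sup>2)) = R x * (1 + x * u x) / (1 + x\<^sup>2)"
    using one_plus_sq_pos[of x] by (simp add: add_divide_eq_iff) (simp add: algebra_simps power2_eq_square)
  ultimately show ?thesis by simp
qed

lemma H'_pos: "0 < R x * (1 + x * u x) / (1 + x\<^sup>2)"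
  by (intro divide_pos_pos mult_pos_pos R_pos one_plus_pos one_plus_sq_pos)

lemma H_strict_mono:
  assumes "x < y" shows "H x < H y"
proof (rule DERIV_pos_imp_increasing[OF assms])
  fix z show "\<exists>d. (H has_real_derivative d) (at z) \<and> 0 < d"
    using H_deriv[of z] H'_pos[of z] by blast
qed

lemma H_less_iff: "H x < H y \<longleftrightarrow> x < y"
  using H_strict_mono[of x y] H_strict_mono[of y x] by (cases x y rule: linorder_cases) auto

lemma R_at_bot: "(R \<longlongrightarrow> 0) at_bot"
proof -
  have "((\<lambda>x::real. exp (- ln (1 + x\<^sup>2) / 2)) \<longlongrightarrow> 0) at_bot" by real_asymp
  then have "((\<lambda>x. - h0 * exp (J x) * exp (- ln (1 + x\<^sup>2) / 2)) \<longlongrightarrow> - h0 * exp 0 * 0) at_bot"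
    by (intro tendsto_intros J_lim)
  then show ?thesis unfolding R_eq[abs_def] by simp
qed

lemma H_at_bot: "(H \<longlongrightarrow> h0) at_bot"
proof -
  have "((\<lambda>x::real. x * exp (- ln (1 + x\<^sup>2) / 2)) \<longlongrightarrow> -1) at_bot" by real_asymp
  then have lim: "((\<lambda>x. - h0 * exp (J x) * (x * exp (- ln (1 + x\<^sup>2) / 2))) \<longlongrightarrow> - h0 * exp 0 * -1) at_bot"
    by (intro tendsto_intros J_lim)
  have "H = (\<lambda>x. - h0 * exp (J x) * (x * exp (- ln (1 + x\<^sup>2) / 2)))"
    unfolding H_def[abs_def] R_eq by (rule ext) (simp only: mult_ac)
  then show ?thesis using lim by (simp only: exp_zero mult_1_right mult_minus_left mult_minus_right minus_minus)
qed

section \<open>Growth of the radius and of the height\<close>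

lemma J_ge:
  assumes "\<And>x. 0 \<le> x \<Longrightarrow> m * x \<le> u x" "0 \<le> x"
  shows "J 0 + m / 2 * ln (1 + x\<^sup>2) \<le> J x"
proof -
  have "J 0 - m / 2 * ln (1 + 0\<^sup>2) \<le> J x - m / 2 * ln (1 + x\<^sup>2)"
  proof (rule DERIV_nonneg_imp_nondecreasing[OF assms(2)])
    fix y :: real assume "0 \<le> y" "y \<le> x"
    have "((\<lambda>x. J x - m / 2 * ln (1 + x\<^sup>2)) has_real_derivative
        u y / (1 + y\<^sup>2) - m / 2 * (2 * y / (1 + y\<^sup>2))) (at y)"
      by (rule DERIV_diff[OF J_deriv DERIV_cmult[OF ln_deriv]])
    moreover have "u y / (1 + y\<^sup>2) - m / 2 * (2 * y / (1 + y\<^sup>2)) = (u y - m * y) / (1 + y\<^sup>2)"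
      by (simp add: diff_divide_distrib)
    moreover have "0 \<le> (u y - m * y) / (1 + y\<^sup>2)"
      using assms(1)[OF \<open>0 \<le> y\<close>] by simp
    ultimately show "\<exists>d. ((\<lambda>x. J x - m / 2 * ln (1 + x\<^sup>2)) has_real_derivative d) (at y) \<and> 0 \<le> d"
      by metis
  qed
  then show ?thesis by simp
qed

lemma J_le:
  assumes "0 \<le> x"
  shows "J x \<le> J 0 + K * (pi / 2) + c / 2 * ln (1 + x\<^sup>2)"
proof -
  \<comment> \<open>The constant part of the bound on \<open>u\<close> integrates to the bounded
    \<open>K * arctan\<close>, so only the slope \<open>c\<close> affects growth.\<close>
  have "J x - (K * arctan x + c / 2 * ln (1 + x\<^sup>2)) \<le> J 0 - (K * arctan 0 + c / 2 * ln (1 + 0\<^sup>2))"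
  proof (rule DERIV_nonpos_imp_nonincreasing[OF assms])
    fix y :: real assume "0 \<le> y" "y \<le> x"
    have "((\<lambda>x. J x - (K * arctan x + c / 2 * ln (1 + x\<^sup>2))) has_real_derivative
        u y / (1 + y\<^sup>2) - (K * (1 / (1 + y\<^sup>2)) + c / 2 * (2 * y / (1 + y\<^sup>2)))) (at y)"
      using DERIV_diff[OF J_deriv DERIV_add[OF DERIV_cmult[OF DERIV_arctan] DERIV_cmult[OF ln_deriv]]]
      unfolding inverse_eq_divide .
    moreover have "u y / (1 + y\<^sup>2) - (K * (1 / (1 + y\<^sup>2)) + c / 2 * (2 * y / (1 + y\<^sup>2)))
        = (u y - (K + c * y)) / (1 + y\<^sup>2)"
      by (simp add: diff_divide_distrib add_divide_distrib)
    ultimately have "((\<lambda>x. J x - (K * arctan x + c / 2 * ln (1 + x\<^sup>2))) has_real_derivative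
        (u y - (K + c * y)) / (1 + y\<^sup>2)) (at y)" by (simp only:)
    moreover have "(u y - (K + c * y)) / (1 + y\<^sup>2) \<le> 0"
      using u_le[of y] \<open>0 \<le> y\<close> one_plus_sq_pos[of y] by (intro divide_nonpos_pos) (auto simp: max_def)
    ultimately show "\<exists>d. ((\<lambda>x. J x - (K * arctan x + c / 2 * ln (1 + x\<^sup>2))) has_real_derivative d) (at y) \<and> d \<le> 0"
      by blast
  qed
  moreover have "K * arctan x \<le> K * (pi / 2)"
    using NC arctan_ubound[of x] by (intro mult_left_mono) auto
  ultimately show ?thesis by simp
qed

lemma R_ge:
  assumes "\<And>x. 0 \<le> x \<Longrightarrow> m * x \<le> u x" "0 \<le> x"
  shows "- h0 * exp (J 0) * exp ((m - 1) / 2 * ln (1 + x\<^sup>2)) \<le> R x"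
proof -
  have "exp (J 0) * exp ((m - 1) / 2 * ln (1 + x\<^sup>2)) \<le> exp (J x - ln (1 + x\<^sup>2) / 2)"
    using J_ge[of m x] assms by (simp add: exp_add[symmetric] algebra_simps diff_divide_distrib)
  then show ?thesis unfolding R_def mult.assoc using h0 by (intro mult_left_mono) auto
qed

lemma R_le:
  assumes "0 \<le> x"
  shows "R x \<le> - h0 * exp (J 0 + K * (pi / 2)) * exp ((c - 1) / 2 * ln (1 + x\<^sup>2))"
proof -
  have "exp (J x - ln (1 + x\<^sup>2) / 2) \<le> exp (J 0 + K * (pi / 2)) * exp ((c - 1) / 2 * ln (1 + x\<^sup>2))"
  proof -
    define a b where "a = c" and "b = J 0 + K * (pi / 2)"
    have "J x - ln (1 + x\<^sup>2) / 2 \<le> b + (a - 1) / 2 * ln (1 + x\<^sup>2)"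
      using J_le[OF assms] unfolding a_def[symmetric] b_def[symmetric] by (simp add: algebra_simps diff_divide_distrib)
    then show ?thesis unfolding a_def b_def exp_add[symmetric] exp_le_cancel_iff .
  qed
  then show ?thesis unfolding R_def mult.assoc using h0 by (intro mult_left_mono) auto
qed

text \<open>\<open>H\<close> grows at least like x^\<epsilon> even if \<open>R\<close> decays, so
  the curve exists for all h > h0.\<close>

lemma H_at_top: "filterlim H at_top at_top"
proof -
  obtain \<epsilon> where \<epsilon>: "0 < \<epsilon>" "\<And>x. 0 \<le> x \<Longrightarrow> \<epsilon> * x < u x" using u_gt_linear by blast
  have "filterlim (\<lambda>x. x * exp ((\<epsilon> - 1) / 2 * ln (1 + x\<^sup>2))) at_top at_top"
  proof -
    have "((\<lambda>x::real. x * exp (- ln (1 + x\<^sup>2) / 2)) \<longlongrightarrow> 1) at_top" by real_asymp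
    moreover have "filterlim (\<lambda>x::real. exp (\<epsilon> / 2 * ln (1 + x\<^sup>2))) at_top at_top"
      using \<epsilon>(1) by real_asymp
    ultimately have "filterlim (\<lambda>x. x * exp (- ln (1 + x\<^sup>2) / 2) * exp (\<epsilon> / 2 * ln (1 + x\<^sup>2))) at_top at_top"
      by (intro filterlim_tendsto_pos_mult_at_top[where c=1]) simp_all
    moreover have "(\<lambda>x::real. x * exp (- ln (1 + x\<^sup>2) / 2) * exp (\<epsilon> / 2 * ln (1 + x\<^sup>2)))
        = (\<lambda>x. x * exp ((\<epsilon> - 1) / 2 * ln (1 + x\<^sup>2)))"
      by (rule ext) (simp add: mult.assoc exp_add[symmetric] algebra_simps diff_divide_distrib)
    ultimately show ?thesis by (simp only:)
  qed
  then have lim: "filterlim (\<lambda>x. (- h0 * exp (J 0)) * (x * exp ((\<epsilon> - 1) / 2 * ln (1 + x\<^sup>2)))) at_top at_top"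
    by (intro filterlim_tendsto_pos_mult_at_top[OF tendsto_const]) (use h0 in \<open>auto simp: mult_neg_pos\<close>)
  have "(- h0 * exp (J 0)) * (x * exp ((\<epsilon> - 1) / 2 * ln (1 + x\<^sup>2))) \<le> H x" if "0 \<le> x" for x
    using mult_left_mono[OF R_ge[of \<epsilon> x] that] \<epsilon> that unfolding H_def
    by (simp add: less_imp_le mult.left_commute mult.assoc)
  then show ?thesis
    by (intro filterlim_at_top_mono[OF lim]) (auto simp: eventually_at_top_linorder)
qed

lemma H_gt: "h0 < H x"
proof -
  have "\<forall>\<^sub>F y in at_bot. H y \<le> H (x - 1)"
    unfolding eventually_at_bot_linorder using H_strict_mono by (metis order_le_less)
  then have "h0 \<le> H (x - 1)" by (rule tendsto_upperbound[OF H_at_bot]) simp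
  then show ?thesis using H_strict_mono[of "x - 1" x] by simp
qed

section \<open>Inverting the height: the curve as a graph over \<open>h\<close>\<close>

lemma H_surj: "h0 < h \<Longrightarrow> \<exists>x. H x = h"
proof -
  assume "h0 < h"
  then have "\<forall>\<^sub>F y in at_bot. H y < h" by (rule order_tendstoD[OF H_at_bot])
  then obtain a where a: "H a < h" unfolding eventually_at_bot_linorder by blast
  have "\<forall>\<^sub>F y in at_top. h < H y" using H_at_top unfolding filterlim_at_top_dense by blast
  then obtain b where b: "h < H b" unfolding eventually_at_top_linorder by blast
  have "a \<le> b" using a b H_less_iff[of a b] by linarith
  then show ?thesis
    using IVT'[of H a h b] a b H_deriv
    by (meson DERIV_isCont continuous_at_imp_continuous_on less_imp_le)
qed

text \<open>For h <= h0 no parameter exists and the value is unspecified, hence the hypothesis h0 <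
  h in what follows.\<close>

definition g :: "real \<Rightarrow> real" where "g h = (THE x. H x = h)"

lemma H_inject: "H x = H y \<longleftrightarrow> x = y"
  using H_less_iff[of x y] H_less_iff[of y x] by (cases x y rule: linorder_cases) simp_all

lemma g_H: "g (H x) = x"
  unfolding g_def H_inject by simp

lemma H_g: "h0 < h \<Longrightarrow> H (g h) = h"
  using H_surj[of h] by (auto simp: g_H)

lemma g_less_iff:
  assumes "h0 < h"
  shows "g h < x \<longleftrightarrow> h < H x" "x < g h \<longleftrightarrow> H x < h"
  using H_less_iff[of "g h" x] H_less_iff[of x "g h"] unfolding H_g[OF assms] by simp_all

lemma g_deriv:
  assumes "h0 < h"
  shows "(g has_real_derivative inverse (R (g h) * (1 + g h * u (g h)) / (1 + (g h)\<^sup>2))) (at h)"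
proof (rule DERIV_inverse_function[where f = H and g = g and x = h and a = h0 and b = "h + 1"])
  have "isCont g (H (g h))"
    by (rule isCont_inverse_function2[where a = "g h - 1" and b = "g h + 1"])
      (auto simp: g_H intro: DERIV_isCont[OF H_deriv])
  then show "isCont g h" using H_g assms by simp
  show "R (g h) * (1 + g h * u (g h)) / (1 + (g h)\<^sup>2) \<noteq> 0"
    using H'_pos[of "g h"] by linarith
qed (use assms in \<open>simp_all add: H_deriv H_g\<close>)

lemma g_at_top: "filterlim g at_top at_top"
  unfolding filterlim_at_top_dense
proof
  fix Z
  have "\<forall>\<^sub>F h in at_top. max h0 (H Z) < h" by (rule eventually_gt_at_top)
  then show "\<forall>\<^sub>F h in at_top. Z < g h" by eventually_elim (auto simp: g_less_iff)
qed

lemma g_at_right: "filterlim g at_bot (at_right h0)"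
  unfolding filterlim_at_bot_dense
proof
  fix Z
  have "\<forall>\<^sub>F h in at_right h0. h \<in> {h0<..<H Z}"
    by (rule eventually_at_right_real[OF H_gt])
  then show "\<forall>\<^sub>F h in at_right h0. g h < Z" by eventually_elim (auto simp: g_less_iff)
qed

definition r :: "real \<Rightarrow> real" where "r h = R (g h)"

lemma r_deriv: "h0 < h \<Longrightarrow> (r has_real_derivative p (g h)) (at h)"
proof -
  assume h: "h0 < h"
  define x where "x = g h"
  have "((\<lambda>h. R (g h)) has_real_derivative
      (R x * (u x - x) / (1 + x\<^sup>2)) * inverse (R x * (1 + x * u x) / (1 + x\<^sup>2))) (at h)"
    unfolding x_def by (rule DERIV_chain2[OF R_deriv g_deriv[OF h]])
  moreover have "(R x * (u x - x) / (1 + x\<^sup>2)) * inverse (R x * (1 + x * u x) / (1 + x\<^sup>2)) = p x"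
  proof -
    have "a / d * inverse (b * w / d) = a / b / w" if "d \<noteq> 0" for a b d w :: real
      using that by (simp add: divide_inverse)
    then show ?thesis using R_pos[of x] one_plus_sq_pos[of x] unfolding p_def by simp
  qed
  ultimately show ?thesis unfolding r_def[abs_def] x_def by simp
qed

lemma deriv_r: "h0 < h \<Longrightarrow> deriv r h = p (g h)"
  by (rule DERIV_imp_deriv[OF r_deriv])

lemma deriv_r_deriv:
  assumes "h0 < h"
  shows "(deriv r has_real_derivative (1 + (u (g h))\<^sup>2) * (1 + (g h)\<^sup>2) * G (g h)
      / (C * R (g h) * (1 + g h * u (g h)) ^ 3)) (at h)"
proof -
  define x where "x = g h"
  have "((\<lambda>h. p (g h)) has_real_derivative
      ((1 + (u x)\<^sup>2) * G x / (C * (1 + x * u x)\<^sup>2)) * inverse (R x * (1 + x * u x) / (1 + x\<^sup>2))) (at h)"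
    unfolding x_def by (rule DERIV_chain2[OF p_deriv g_deriv[OF assms]])
  moreover have "((1 + (u x)\<^sup>2) * G x / (C * (1 + x * u x)\<^sup>2)) * inverse (R x * (1 + x * u x) / (1 + x\<^sup>2))
      = (1 + (u x)\<^sup>2) * (1 + x\<^sup>2) * G x / (C * R x * (1 + x * u x) ^ 3)"
    by (simp add: power3_eq_cube power2_eq_square divide_inverse mult_ac)
  ultimately have "((\<lambda>h. p (g h)) has_real_derivative
      (1 + (u x)\<^sup>2) * (1 + x\<^sup>2) * G x / (C * R x * (1 + x * u x) ^ 3)) (at h)" by simp
  then show ?thesis unfolding x_def
    by (rule has_field_derivative_transform_within_open[of _ _ _ "{h0<..}"])
      (use assms deriv_r in auto)
qed

lemmas deriv_deriv_r = DERIV_imp_deriv[OF deriv_r_deriv]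

lemma sgn_deriv_deriv_r: "h0 < h \<Longrightarrow> sgn (deriv (deriv r) h) = sgn (G (g h))"
  using one_plus_pos[of "g h"] R_pos[of "g h"] C_pos one_plus_sq_pos[of "g h"] one_plus_sq_pos[of "u (g h)"]
  by (simp add: deriv_deriv_r sgn_mult sgn_divide)

text \<open>In the variable \<open>x\<close> the equation, multiplied by C R w, becomes the
  definition of \<open>G\<close>.\<close>

lemma r_solution:
  assumes "h0 < h"
  shows "r h - h * deriv r h \<noteq> 0"
    "deriv (deriv r) h / (1 + (deriv r h)\<^sup>2)
      = (N - 1) / r h - (1 + (deriv r h)\<^sup>2) / (C * (r h - h * deriv r h))"
proof -
  define x w where "x = g h" and "w = 1 + x * u x"
  have w: "0 < w" unfolding w_def by (rule one_plus_pos)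
  have pos: "0 < R x" "0 < C" "0 < 1 + x\<^sup>2" "0 < 1 + (u x)\<^sup>2"
    using R_pos C_pos one_plus_sq_pos by auto
  have h: "h = x * R x" using H_g[OF assms] unfolding x_def H_def by simp
  have xp: "1 - x * p x = (1 + x\<^sup>2) / w"
  proof -
    have "w * (1 - x * p x) = w - x * (u x - x)" using w unfolding p_def w_def[symmetric]
      by (simp add: field_simps)
    also have "\<dots> = 1 + x\<^sup>2" unfolding w_def by algebra
    finally show ?thesis using w by (simp add: field_simps)
  qed
  have rh: "r h - h * deriv r h = R x * (1 + x\<^sup>2) / w"
  proof -
    have "r h - h * deriv r h = R x * (1 - x * p x)"
    proof -
      have "r h = R x" "deriv r h = p x" using deriv_r[OF assms] by (simp_all add: r_def x_def)
      then show ?thesis using h by (simp add: algebra_simps)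
    qed
    then show ?thesis unfolding xp by simp
  qed
  then show "r h - h * deriv r h \<noteq> 0" using pos w by simp
  have p2: "1 + (deriv r h)\<^sup>2 = (1 + x\<^sup>2) * (1 + (u x)\<^sup>2) / w\<^sup>2"
  proof -
    have "w\<^sup>2 * (1 + (p x)\<^sup>2) = w\<^sup>2 + (u x - x)\<^sup>2" using w unfolding p_def w_def[symmetric]
      by (simp add: field_simps)
    \<comment> \<open>Lagrange's identity for (1 + x u)^2 + (u - x)^2.\<close>
    also have "\<dots> = (1 + x\<^sup>2) * (1 + (u x)\<^sup>2)" unfolding w_def by algebra
    finally show ?thesis using w unfolding deriv_r[OF assms] x_def[symmetric] by (simp add: field_simps)
  qed
  have dd: "deriv (deriv r) h = (1 + (u x)\<^sup>2) * (1 + x\<^sup>2) * G x / (C * R x * w ^ 3)"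
    unfolding x_def w_def using assms by (simp add: deriv_deriv_r)
  have "deriv (deriv r) h / (1 + (deriv r h)\<^sup>2) = G x / (C * R x * w)"
    unfolding dd p2 using pos w by (simp add: power3_eq_cube power2_eq_square)
  moreover have "(1 + (deriv r h)\<^sup>2) / (C * (r h - h * deriv r h)) = (1 + (u x)\<^sup>2) / (C * R x * w)"
    unfolding p2 rh using pos w by (simp add: power2_eq_square)
  moreover have "G x / (C * R x * w) = (N - 1) / R x - (1 + (u x)\<^sup>2) / (C * R x * w)"
    unfolding G_def w_def[symmetric] using pos w by (simp add: diff_divide_distrib)
  ultimately show "deriv (deriv r) h / (1 + (deriv r h)\<^sup>2)
      = (N - 1) / r h - (1 + (deriv r h)\<^sup>2) / (C * (r h - h * deriv r h))"
    unfolding r_def x_def by simp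
qed

lemma r_expander_solution:
  assumes "N = real n"
  shows "expander_solution_on n C {h0<..} r"
  unfolding expander_solution_on_def
  using r_deriv deriv_r_deriv r_solution R_pos assms
  by (auto simp: r_def real_differentiable_def)

lemma r_meets_axis: "meets_axis_perpendicularly_at r h0"
  unfolding meets_axis_perpendicularly_at_def
proof
  show "(r \<longlongrightarrow> 0) (at_right h0)"
    unfolding r_def[abs_def] by (rule filterlim_compose[OF R_at_bot g_at_right])
  have "filterlim p at_top at_bot"
    by (rule filterlim_at_top_mono[OF filterlim_uminus_at_top_at_bot])
      (auto simp: eventually_at_bot_linorder intro!: exI[of _ 0] p_ge)
  then have "filterlim (\<lambda>h. p (g h)) at_top (at_right h0)" by (rule filterlim_compose[OF _ g_at_right])
  moreover have "\<forall>\<^sub>F h in at_right h0. p (g h) = deriv r h"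
    using eventually_at_right_less[of h0] by eventually_elim (simp add: deriv_r)
  ultimately show "filterlim (deriv r) at_top (at_right h0)"
    by (simp add: filterlim_cong[OF refl refl, of "\<lambda>h. p (g h)" "deriv r"])
qed

section \<open>Convexity and asymptotics in the three ranges of \<open>c\<close>\<close>

lemma G_neg:
  assumes "\<And>x. x < u x"
  shows "G x < 0"
proof (cases "x \<le> 0")
  case False
  have "0 < - G x"
  proof (rule stays_positive[of 0 x "\<lambda>x. - G x" "\<lambda>x. - (c * (u x + x * F x (u x)) - 2 * u x * F x (u x))"])
    fix z assume z: "- G z = 0"
    have "(1 + (u z)\<^sup>2) * (z - u z) / (1 + z\<^sup>2) < 0"
      using assms[of z] one_plus_sq_pos[of z] one_plus_sq_pos[of "u z"]
      by (intro divide_neg_pos mult_pos_neg) auto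
    then show "0 < - (c * (u z + z * F z (u z)) - 2 * u z * F z (u z))"
      using G_deriv_at_zero[of z] z by simp
  qed (use False G_neg_left[of 0] in \<open>auto intro!: derivative_eq_intros G_deriv\<close>)
  then show ?thesis by simp
qed (rule G_neg_left)

lemma increasing_concave:
  assumes "\<And>x. x < u x" "h0 < h"
  shows "0 < deriv r h" "deriv (deriv r) h < 0"
proof -
  show "0 < deriv r h"
    using assms(1)[of "g h"] one_plus_pos[of "g h"] unfolding deriv_r[OF assms(2)] p_def by simp
  have "sgn (deriv (deriv r) h) = -1"
    using sgn_deriv_deriv_r[OF assms(2)] G_neg[OF assms(1)] by (simp add: sgn_neg)
  then show "deriv (deriv r) h < 0" by (simp add: sgn_1_neg)
qed

text \<open>u > x makes \<open>R\<close> nondecreasing, and at c = 1 the exponent in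
  \<open>R_le\<close> vanishes, so \<open>R\<close> is bounded.\<close>

lemma critical_case:
  assumes "c = 1"
  obtains rtop where "0 < rtop" "(r \<longlongrightarrow> rtop) at_top"
proof -
  have R_mono: "R x \<le> R y" if "x \<le> y" for x y
  proof (rule DERIV_nonneg_imp_nondecreasing[OF that])
    fix z
    have "0 \<le> R z * (u z - z) / (1 + z\<^sup>2)"
      using R_pos[of z] u_gt_critical[OF assms, of z] one_plus_sq_pos[of z] by simp
    then show "\<exists>d. (R has_real_derivative d) (at z) \<and> 0 \<le> d" using R_deriv by blast
  qed
  have "R x \<le> - h0 * exp (J 0 + K * (pi / 2))" for x
    using R_mono[of x "max 0 x"] R_le[of "max 0 x"] assms by simp
  then obtain l where l: "(R \<longlongrightarrow> l) at_top" "\<And>x. R x \<le> l"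
    using mono_bounded_tendsto_at_top[of R] R_mono by (metis monoI)
  have "0 < l" using R_pos[of 0] l(2)[of 0] by linarith
  moreover have "(r \<longlongrightarrow> l) at_top"
    unfolding r_def[abs_def] by (rule filterlim_compose[OF l(1) g_at_top])
  ultimately show ?thesis by (rule that)
qed

lemma u_gt_supercritical: "1 < c \<Longrightarrow> x < u x"
proof (cases "0 \<le> x")
  case True
  assume "1 < c"
  then obtain m where m: "1 < m" "\<And>x. 0 \<le> x \<Longrightarrow> m * x < u x"
    by (rule u_gt_super) blast
  have "1 * x \<le> m * x" using m(1) True by (intro mult_right_mono) auto
  then show ?thesis using m(2)[OF True] by simp
qed (use u_pos[of x] in simp)

lemma supercritical_case:
  assumes "1 < c"
  shows "filterlim r at_top at_top"
proof -
  obtain m where m: "1 < m" "\<And>x. 0 \<le> x \<Longrightarrow> m * x < u x" using u_gt_super[OF assms] by blast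
  have "filterlim (\<lambda>x::real. exp ((m - 1) / 2 * ln (1 + x\<^sup>2))) at_top at_top"
  proof -
    define d where "d = (m - 1) / 2"
    have "0 < d" using m(1) unfolding d_def by simp
    then show ?thesis unfolding d_def[symmetric] by real_asymp
  qed
  then have lim: "filterlim (\<lambda>x. (- h0 * exp (J 0)) * exp ((m - 1) / 2 * ln (1 + x\<^sup>2))) at_top at_top"
    by (intro filterlim_tendsto_pos_mult_at_top[OF tendsto_const]) (use h0 in \<open>auto simp: mult_neg_pos\<close>)
  have "- h0 * exp (J 0) * exp ((m - 1) / 2 * ln (1 + x\<^sup>2)) \<le> R x" if "0 \<le> x" for x
    using R_ge[of m x] m that by (simp add: less_imp_le)
  then have "filterlim R at_top at_top"
    by (intro filterlim_at_top_mono[OF lim]) (auto simp: eventually_at_top_linorder)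
  then show ?thesis unfolding r_def[abs_def] by (rule filterlim_compose[OF _ g_at_top])
qed

text \<open>Otherwise \<open>r'\<close> never increases. It is negative once u < x, so the curve
  would stay below a descending line, which is impossible with r > 0 and \<open>h\<close>
  unbounded.\<close>

lemma G_somewhere_pos:
  assumes "c < 1"
  obtains b where "0 < G b"
proof (rule ccontr)
  assume "\<not> thesis"
  then have G: "G x \<le> 0" for x using that by (meson not_le_imp_less)
  \<comment> \<open>Here the upper bound K + c x equals x - 1, so u < x.\<close>
  define x1 where "x1 = (K + 1) / (1 - c)"
  have x1: "0 < x1" unfolding x1_def using NC assms by simp
  have "(1 - c) * x1 = K + 1" unfolding x1_def using assms by simp
  then have "K + c * x1 < x1" by (simp add: algebra_simps)
  then have "u x1 < x1" using u_le[of x1] x1 by (simp add: max_def)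
  then have p1: "p x1 < 0" unfolding p_def using one_plus_pos[of x1] by (simp add: divide_neg_pos)
  have p_dec: "p y \<le> p x1" if "x1 \<le> y" for y
  proof (rule DERIV_nonpos_imp_nonincreasing[OF that])
    fix z
    have "(1 + (u z)\<^sup>2) * G z / (C * (1 + z * u z)\<^sup>2) \<le> 0"
      using G[of z] C_pos one_plus_pos[of z] one_plus_sq_pos[of "u z"]
      by (intro divide_nonpos_pos mult_nonneg_nonpos) auto
    then show "\<exists>d. (p has_real_derivative d) (at z) \<and> d \<le> 0" using p_deriv by blast
  qed
  have bound: "R y - p x1 * H y \<le> R x1 - p x1 * H x1" if "x1 \<le> y" for y
  proof (rule DERIV_nonpos_imp_nonincreasing[OF that])
    fix z assume "x1 \<le> z"
    have "((\<lambda>y. R y - p x1 * H y) has_real_derivative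
        R z * (u z - z) / (1 + z\<^sup>2) - p x1 * (R z * (1 + z * u z) / (1 + z\<^sup>2))) (at z)"
      by (auto intro!: derivative_eq_intros R_deriv H_deriv)
    moreover have "R z * (u z - z) / (1 + z\<^sup>2) - p x1 * (R z * (1 + z * u z) / (1 + z\<^sup>2)) \<le> 0"
    proof -
      have "R z * (u z - z) / (1 + z\<^sup>2) = p z * (R z * (1 + z * u z) / (1 + z\<^sup>2))"
        unfolding p_def using one_plus_pos[of z] by simp
      also have "\<dots> \<le> p x1 * (R z * (1 + z * u z) / (1 + z\<^sup>2))"
        by (rule mult_right_mono[OF p_dec[OF \<open>x1 \<le> z\<close>] less_imp_le[OF H'_pos]])
      finally show ?thesis by simp
    qed
    ultimately show "\<exists>d. ((\<lambda>y. R y - p x1 * H y) has_real_derivative d) (at z) \<and> d \<le> 0" by blast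
  qed
  have "\<forall>\<^sub>F y in at_top. (R x1 - p x1 * H x1) / (- p x1) < H y"
    using H_at_top unfolding filterlim_at_top_dense by blast
  moreover have "\<forall>\<^sub>F y in at_top. x1 \<le> y" by (rule eventually_ge_at_top)
  ultimately have "\<forall>\<^sub>F y in at_top. (R x1 - p x1 * H x1) / (- p x1) < H y \<and> x1 \<le> y"
    by (rule eventually_conj)
  then obtain y where y: "(R x1 - p x1 * H x1) / (- p x1) < H y" "x1 \<le> y"
    unfolding eventually_at_top_linorder by blast
  have "0 < - p x1" using p1 by simp
  then have "R x1 - p x1 * H x1 < H y * (- p x1)" using y(1) by (simp only: pos_divide_less_eq)
  then show False using bound[OF y(2)] R_pos[of y] by (simp add: mult.commute)
qed

lemma subcritical_sign:
  assumes "c < 1"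
  obtains x1 where "\<And>x. sgn (G x) = sgn (x - x1)"
proof -
  have up: "0 < c * (u z + z * F z (u z)) - 2 * u z * F z (u z)" if "G z = 0" for z
  proof -
    \<comment> \<open>If u >= z, then 1 + u^2 = c (1 + z u) < 1 + z u <= 1 + u^2.\<close>
    have "u z < z"
    proof (rule ccontr)
      assume "\<not> u z < z"
      then have "z * u z \<le> (u z)\<^sup>2" using u_pos[of z] by (simp add: power2_eq_square mult_right_mono)
      moreover have "c * (1 + z * u z) < 1 * (1 + z * u z)"
        using assms one_plus_pos[of z] by (intro mult_strict_right_mono)
      ultimately show False using that unfolding G_def by simp
    qed
    then show ?thesis
      unfolding G_deriv_at_zero[OF that] using one_plus_sq_pos[of z] one_plus_sq_pos[of "u z"] by simp
  qed
  have mono: "0 < G y" if "x < y" "0 \<le> G x" for x y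
    by (rule stays_positive[of x y G "\<lambda>z. c * (u z + z * F z (u z)) - 2 * u z * F z (u z)"])
      (use that up G_deriv in auto)
  obtain b where b: "0 < G b" using G_somewhere_pos[OF assms] by blast
  then have "0 < b" using G_neg_left[of b] by (cases "b \<le> 0") auto
  then have "\<exists>x\<ge>0. x \<le> b \<and> G x = 0"
    using G_neg_left[of 0] b G_deriv
    by (intro IVT') (auto intro!: continuous_at_imp_continuous_on DERIV_isCont)
  then obtain x1 where x1: "G x1 = 0" by blast
  have "sgn (G x) = sgn (x - x1)" for x
  proof (cases x x1 rule: linorder_cases)
    case less
    then have "G x < 0" using mono[of x x1] x1 by fastforce
    then show ?thesis using less by simp
  next
    case greater
    then show ?thesis using mono[of x1 x] x1 by simp
  qed (use x1 in simp)
  then show ?thesis by (rule that)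
qed

lemma subcritical_case:
  assumes "c < 1"
  shows "\<exists>h1>h0. \<forall>h>h0. sgn (deriv (deriv r) h) = sgn (h - h1)" "(r \<longlongrightarrow> 0) at_top"
proof -
  obtain x1 where x1: "\<And>x. sgn (G x) = sgn (x - x1)" using subcritical_sign[OF assms] by blast
  have "sgn (deriv (deriv r) h) = sgn (h - H x1)" if "h0 < h" for h
    unfolding sgn_deriv_deriv_r[OF that] x1
    using g_less_iff[OF that, of x1] by (auto simp: sgn_if)
  then show "\<exists>h1>h0. \<forall>h>h0. sgn (deriv (deriv r) h) = sgn (h - h1)" using H_gt by blast
  have "((\<lambda>x::real. exp ((c - 1) / 2 * ln (1 + x\<^sup>2))) \<longlongrightarrow> 0) at_top"
  proof -
    define d where "d = (c - 1) / 2"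
    have "d < 0" using assms unfolding d_def by simp
    then show ?thesis unfolding d_def[symmetric] by real_asymp
  qed
  then have lim: "((\<lambda>x. - h0 * exp (J 0 + K * (pi / 2)) * exp ((c - 1) / 2 * ln (1 + x\<^sup>2))) \<longlongrightarrow> 0) at_top"
    by (rule tendsto_mult_right_zero)
  have "(R \<longlongrightarrow> 0) at_top"
  proof (rule tendsto_sandwich[OF _ _ tendsto_const lim])
    show "\<forall>\<^sub>F x in at_top. 0 \<le> R x" by (simp add: R_pos less_imp_le)
    show "\<forall>\<^sub>F x in at_top. R x \<le> - h0 * exp (J 0 + K * (pi / 2)) * exp ((c - 1) / 2 * ln (1 + x\<^sup>2))"
      unfolding eventually_at_top_linorder using R_le by blast
  qed
  then show "(r \<longlongrightarrow> 0) at_top" unfolding r_def[abs_def] by (rule filterlim_compose[OF _ g_at_top])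
qed

end

text \<open>For x <= 0 the bound u <= K keeps the integral of u/(1 + x^2) from -infinity below K
  pi/2, so an antiderivative has a limit there; subtracting it places the axis point at
  \<open>h0\<close>.\<close>

lemma (in expander_ode) profile_exists:
  assumes "h0 < 0"
  obtains u J where "expander_profile N C u J h0"
proof -
  obtain u where u: "\<And>x. (u has_real_derivative F x (u x)) (at x)" "\<And>x. 0 \<le> u x" "\<And>x. u x \<le> upper x"
    using solution_exists by blast
  have "continuous_on UNIV u"
    using u(1) by (intro continuous_at_imp_continuous_on) (auto intro: DERIV_isCont)
  then have "continuous_on UNIV (\<lambda>x. u x / (1 + x\<^sup>2))"
    by (intro continuous_intros) (use one_plus_sq_pos in \<open>auto simp: less_imp_neq[symmetric]\<close>)
  then obtain J where J: "\<And>x. (J has_real_derivative u x / (1 + x\<^sup>2)) (at x)"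
    using antiderivative_exists by blast
  have J_mono: "J x \<le> J y" if "x \<le> y" for x y
  proof (rule DERIV_nonneg_imp_nondecreasing[OF that])
    fix z
    have "0 \<le> u z / (1 + z\<^sup>2)" using u(2)[of z] by simp
    then show "\<exists>d. (J has_real_derivative d) (at z) \<and> 0 \<le> d" using J by blast
  qed
  have J_bound: "J 0 - J x \<le> K * (pi / 2)" if "x \<le> 0" for x
  proof -
    have "K * arctan x - J x \<le> K * arctan 0 - J 0"
    proof (rule DERIV_nonneg_imp_nondecreasing[OF that])
      fix y :: real assume "y \<le> 0"
      have "((\<lambda>x. K * arctan x - J x) has_real_derivative K * inverse (1 + y\<^sup>2) - u y / (1 + y\<^sup>2)) (at y)"
        by (rule DERIV_diff[OF DERIV_cmult[OF DERIV_arctan] J])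
      moreover have "K * inverse (1 + y\<^sup>2) - u y / (1 + y\<^sup>2) = (K - u y) / (1 + y\<^sup>2)"
        by (simp add: divide_inverse left_diff_distrib)
      moreover have "0 \<le> (K - u y) / (1 + y\<^sup>2)"
        using u(3)[of y] upper_le[of y] \<open>y \<le> 0\<close> by (intro divide_nonneg_nonneg) (simp_all add: max_def split: if_splits)
      ultimately show "\<exists>d. ((\<lambda>x. K * arctan x - J x) has_real_derivative d) (at y) \<and> 0 \<le> d"
        by metis
    qed
    moreover have "K * (- (pi / 2)) \<le> K * arctan x"
      using NC arctan_lbound[of x] by (intro mult_left_mono) auto
    ultimately show ?thesis by simp
  qed
  \<comment> \<open>Reflection moves the limit to +infinity; \<open>max\<close> and monotonicity
    extend the bound to all real x.\<close>
  have "- J (- x) \<le> K * (pi / 2) - J 0" for x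
    using J_bound[of "- max 0 x"] J_mono[of "- max 0 x" "- x"] by simp
  moreover have "mono (\<lambda>x. - J (- x))" using J_mono by (auto intro: monoI)
  ultimately obtain l where "((\<lambda>x. - J (- x)) \<longlongrightarrow> l) at_top"
    using mono_bounded_tendsto_at_top[of "\<lambda>x. - J (- x)" "K * (pi / 2) - J 0"] by blast
  then have "((\<lambda>x. J (- x)) \<longlongrightarrow> - l) at_top" using tendsto_minus by fastforce
  then have "(J \<longlongrightarrow> - l) at_bot" by (simp add: filterlim_at_bot_mirror)
  then have "((\<lambda>x. J x + l) \<longlongrightarrow> - l + l) at_bot" by (intro tendsto_intros)
  then have "((\<lambda>x. J x + l) \<longlongrightarrow> 0) at_bot" by simp
  moreover have "((\<lambda>x. J x + l) has_real_derivative u x / (1 + x\<^sup>2)) (at x)" for x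
    using DERIV_add[OF J[of x] DERIV_const[of l]] by simp
  ultimately have "expander_profile N C u (\<lambda>x. J x + l) h0"
    using u assms by unfold_locales auto
  then show ?thesis by (rule that)
qed

theorem theorem20:
  fixes n :: nat and C h0 :: real
  assumes "n \<ge> 2" and "C > 1 / real n" and "h0 < 0"
  shows "\<exists>r :: real \<Rightarrow> real.
    expander_solution_on n C {h0<..} r \<and>
    meets_axis_perpendicularly_at r h0 \<and>
    (C = 1 / (real n - 1) \<longrightarrow>
       (\<forall>h>h0. deriv r h > 0 \<and> deriv (deriv r) h < 0) \<and>
       (\<exists>rtop>0. (r \<longlongrightarrow> rtop) at_top)) \<and>
    (C > 1 / (real n - 1) \<longrightarrow>
       (\<forall>h>h0. deriv r h > 0 \<and> deriv (deriv r) h < 0) \<and>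
       filterlim r at_top at_top) \<and>
    (1 / real n < C \<and> C < 1 / (real n - 1) \<longrightarrow>
       (\<exists>h1>h0. \<forall>h>h0. sgn (deriv (deriv r) h) = sgn (h - h1)) \<and>
       (r \<longlongrightarrow> 0) at_top)"
proof -
  have n: "2 \<le> real n" using assms(1) by simp
  have "1 < real n * C" using assms(1,2) by (simp add: field_simps)
  then interpret expander_ode "real n" C using n by unfold_locales auto
  obtain u J where "expander_profile (real n) C u J h0" using profile_exists[OF assms(3)] .
  then interpret expander_profile "real n" C u J h0 .
  have cases: "C = 1 / (real n - 1) \<longleftrightarrow> c = 1" "C > 1 / (real n - 1) \<longleftrightarrow> c > 1"
    "C < 1 / (real n - 1) \<longleftrightarrow> c < 1"
    using n by (auto simp: field_simps)
  have "\<exists>rtop>0. (r \<longlongrightarrow> rtop) at_top" if "c = 1"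
    using critical_case[OF that] by blast
  then show ?thesis
    unfolding cases
    using r_expander_solution[OF refl] r_meets_axis increasing_concave u_gt_critical u_gt_supercritical
      supercritical_case subcritical_case
    by (intro exI[of _ r]) simp
qed

end
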